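(* Every group word $w$ is strongly concise in the class of nilpotent profinite groups; that is, for every group word $w$ and every profinite group $G$ that is nilpotent, if $\lvert G_w\rvert < 2^{\aleph_0}$ then the verbal subgroup $w(G)$ is finite.
   Context: A group word $w=w(x_1,\ldots,x_r)$ is an element of the free group on $x_1,\ldots,x_r$. For a profinite group $G$, $G_w=\{w(g_1,\ldots,g_r)\mid g_1,\ldots,g_r\in G\}$ is the set of $w$-values in $G$, and $w(G)$ is the closed subgroup of $G$ generated by $G_w$. *)

theory Defs
  imports
    "HOL-Analysis.Analysis"
    "HOL-Algebra.Generated_Groups"
    "HOL-Library.Equipollence"
begin

section \<open>Free groups and group words\<close>

text \<open>
  The free group on a set \<open>A\<close> is realised on the reduced words over the letters \<open>(x, b)\<close>,
  \<open>x \<in> A\<close>, where \<open>(x, True)\<close> stands for the generator \<open>x\<close> and \<open>(x, False)\<close> for its inverse.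
\<close>

definition push :: "'x \<times> bool \<Rightarrow> ('x \<times> bool) list \<Rightarrow> ('x \<times> bool) list" where
  "push a w =
     (case w of
        [] \<Rightarrow> [a]
      | b # v \<Rightarrow> if fst a = fst b \<and> snd a \<noteq> snd b then v else a # w)"

fun reduced :: "('x \<times> bool) list \<Rightarrow> bool" where
  "reduced [] \<longleftrightarrow> True"
| "reduced [a] \<longleftrightarrow> True"
| "reduced (a # b # w) \<longleftrightarrow> \<not> (fst a = fst b \<and> snd a \<noteq> snd b) \<and> reduced (b # w)"

definition free_group :: "'x set \<Rightarrow> ('x \<times> bool) list monoid" where
  "free_group A =
     \<lparr>carrier = {w. reduced w \<and> fst ` set w \<subseteq> A},
      mult = (\<lambda>u v. foldr push u v),
      one = []\<rparr>"

definition word_value ::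
    "('a, 'b) monoid_scheme \<Rightarrow> ('x \<Rightarrow> 'a) \<Rightarrow> ('x \<times> bool) list \<Rightarrow> 'a" where
  "word_value G g w =
     foldr (\<lambda>(x, b) y. (if b then g x else inv\<^bsub>G\<^esub> (g x)) \<otimes>\<^bsub>G\<^esub> y) w \<one>\<^bsub>G\<^esub>"

lemma reduced_Cons_D: "reduced (a # w) \<Longrightarrow> reduced w"
  by (cases w) auto

lemma reduced_push: "reduced w \<Longrightarrow> reduced (push a w)"
  by (cases w) (auto simp: push_def dest: reduced_Cons_D)

lemma set_push: "set (push a w) \<subseteq> insert a (set w)"
  by (auto simp: push_def split: list.splits if_splits)

lemma reduced_foldr_push: "reduced v \<Longrightarrow> reduced (foldr push u v)"
  by (induction u) (auto intro: reduced_push)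

lemma set_foldr_push: "set (foldr push u v) \<subseteq> set u \<union> set v"
proof (induction u)
  case (Cons a u)
  then show ?case using set_push[of a "foldr push u v"] by auto
qed simp

lemma foldr_push_Nil: "reduced w \<Longrightarrow> foldr push w [] = w"
proof (induction w)
  case (Cons a w)
  then show ?case by (cases w) (auto simp: push_def dest: reduced_Cons_D)
qed simp

lemma push_push_inverse: "reduced w \<Longrightarrow> push (x, b) (push (x, \<not> b) w) = w"
  by (cases w rule: reduced.cases) (auto simp: push_def)

lemma foldr_push_push: "reduced w \<Longrightarrow> foldr push (push a v) w = push a (foldr push v w)"
proof (cases v)
  case (Cons b v')
  assume w: "reduced w"
  show ?thesis
  proof (cases "fst a = fst b \<and> snd a \<noteq> snd b")
    case True
    then have a: "a = (fst b, \<not> snd b)" by (cases a) auto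
    have "push a (push b (foldr push v' w)) = foldr push v' w"
      using push_push_inverse[OF reduced_foldr_push[OF w], of "fst b" "\<not> snd b" v']
      by (simp add: a)
    moreover have "push a v = v'" using True Cons by (simp add: push_def)
    ultimately show ?thesis using Cons by simp
  qed (auto simp: push_def[of a "b # v'"] Cons)
qed (simp add: push_def)

lemma foldr_push_assoc:
  "reduced w \<Longrightarrow> foldr push (foldr push u v) w = foldr push u (foldr push v w)"
  by (induction u) (auto simp: foldr_push_push)

lemma foldr_push_inverse:
  assumes "reduced v"
  shows "foldr push (map (\<lambda>(x, b). (x, \<not> b)) (rev w)) (foldr push w v) = v"
  using assms
proof (induction w arbitrary: v)
  case (Cons a w)
  obtain x b where a: "a = (x, b)" by (cases a)
  show ?case
    using Cons push_push_inverse[OF reduced_foldr_push[OF Cons.prems], of x "\<not> b" w]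
    by (simp add: a)
qed simp

lemma group_free_group: "group (free_group A)"
proof (rule groupI)
  fix w assume "w \<in> carrier (free_group A)"
  then have w: "reduced w" "fst ` set w \<subseteq> A" by (auto simp: free_group_def)
  let ?u = "foldr push (map (\<lambda>(x, b). (x, \<not> b)) (rev w)) []"
  have "?u \<in> carrier (free_group A)"
    using w set_foldr_push[of "map (\<lambda>(x, b). (x, \<not> b)) (rev w)" "[]"]
    by (force simp: free_group_def intro!: reduced_foldr_push)
  moreover have "?u \<otimes>\<^bsub>free_group A\<^esub> w = \<one>\<^bsub>free_group A\<^esub>"
    using foldr_push_inverse[of "[]" w] w
    by (simp add: free_group_def foldr_push_assoc foldr_push_Nil)
  ultimately show "\<exists>u\<in>carrier (free_group A). u \<otimes>\<^bsub>free_group A\<^esub> w = \<one>\<^bsub>free_group A\<^esub>"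
    by blast
next
  fix u v assume "u \<in> carrier (free_group A)" "v \<in> carrier (free_group A)"
  then show "u \<otimes>\<^bsub>free_group A\<^esub> v \<in> carrier (free_group A)"
    using set_foldr_push[of u v] by (force simp: free_group_def intro!: reduced_foldr_push)
qed (auto simp: free_group_def foldr_push_assoc)

context group
begin

lemma word_value_closed:
  "\<lbrakk>g \<in> A \<rightarrow> carrier G; fst ` set w \<subseteq> A\<rbrakk> \<Longrightarrow> word_value G g w \<in> carrier G"
  by (induction w) (auto simp: word_value_def dest: funcset_mem)

lemma word_value_push:
  assumes g: "g \<in> A \<rightarrow> carrier G" and w: "fst ` set w \<subseteq> A" "fst a \<in> A"
  shows "word_value G g (push a w) = word_value G g (a # w)"
proof (cases w)
  case (Cons b v)
  have "word_value G g v \<in> carrier G"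
    using word_value_closed[OF g] w Cons by auto
  moreover have "g (fst a) \<in> carrier G" using g w by auto
  ultimately show ?thesis
    using Cons by (cases a; cases b) (auto simp: push_def word_value_def m_assoc[symmetric])
qed (simp add: push_def)

text \<open>
  Hence \<open>word_value G g\<close> is the homomorphism from the free group on \<open>A\<close> to \<open>G\<close> that
  extends \<open>g\<close>.
\<close>

lemma word_value_hom:
  assumes g: "g \<in> A \<rightarrow> carrier G"
  shows "word_value G g \<in> hom (free_group A) G"
proof (rule homI)
  fix u v assume "u \<in> carrier (free_group A)" "v \<in> carrier (free_group A)"
  then have u: "fst ` set u \<subseteq> A" and v: "fst ` set v \<subseteq> A" by (auto simp: free_group_def)
  from u have "word_value G g (foldr push u v) = word_value G g u \<otimes> word_value G g v"
  proof (induction u)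
    case Nil
    then show ?case
      using word_value_closed[OF g v] by (simp add: word_value_def)
  next
    case (Cons a u)
    have "fst ` set (foldr push u v) \<subseteq> A"
      using set_foldr_push[of u v] Cons.prems v by force
    then have "word_value G g (foldr push (a # u) v) = word_value G g (a # foldr push u v)"
      using word_value_push[OF g] Cons.prems by simp
    moreover have "word_value G g u \<in> carrier G" "word_value G g v \<in> carrier G"
      "g (fst a) \<in> carrier G"
      using word_value_closed[OF g] Cons.prems v g by auto
    ultimately show ?case
      using Cons by (cases a) (auto simp: word_value_def m_assoc)
  qed
  then show "word_value G g (u \<otimes>\<^bsub>free_group A\<^esub> v) = word_value G g u \<otimes> word_value G g v"
    by (simp add: free_group_def)
qed (use word_value_closed[OF g] in \<open>auto simp: free_group_def\<close>)

lemma word_value_generator: "g x \<in> carrier G \<Longrightarrow> word_value G g [(x, True)] = g x"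
  by (simp add: word_value_def)

end


section \<open>Profinite groups\<close>

locale topological_group = group G for G (structure) and T :: "'a topology" +
  assumes topspace_eq: "topspace T = carrier G"
    and continuous_mult: "continuous_map (prod_topology T T) T (\<lambda>(x, y). x \<otimes> y)"
    and continuous_inv: "continuous_map T T (\<lambda>x. inv x)"

locale profinite_group = topological_group +
  assumes compact: "compact_space T"
    and Hausdorff: "Hausdorff_space T"
    and totally_disconnected:
      "\<And>x. x \<in> carrier G \<Longrightarrow> connected_component_of_set T x = {x}"


section \<open>Nilpotent groups\<close>

text \<open>
  Nilpotency is that of the abstract group. For profinite groups nothing changes if the
  closures of the terms of the lower central series are taken instead.
\<close>

definition commutator_subgroup ::
    "('a, 'b) monoid_scheme \<Rightarrow> 'a set \<Rightarrow> 'a set \<Rightarrow> 'a set" where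
  "commutator_subgroup G H K =
     generate G {h \<otimes>\<^bsub>G\<^esub> k \<otimes>\<^bsub>G\<^esub> inv\<^bsub>G\<^esub> h \<otimes>\<^bsub>G\<^esub> inv\<^bsub>G\<^esub> k | h k. h \<in> H \<and> k \<in> K}"

text \<open>Indexed from \<open>0\<close>: \<open>lower_central G n\<close> is the term usually written \<open>\<gamma>\<close> with index \<open>n + 1\<close>.\<close>

primrec lower_central :: "('a, 'b) monoid_scheme \<Rightarrow> nat \<Rightarrow> 'a set" where
  "lower_central G 0 = carrier G"
| "lower_central G (Suc n) = commutator_subgroup G (lower_central G n) (carrier G)"

definition nilpotent_group :: "('a, 'b) monoid_scheme \<Rightarrow> bool" where
  "nilpotent_group G \<longleftrightarrow> group G \<and> (\<exists>c. lower_central G c = {\<one>\<^bsub>G\<^esub>})"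


section \<open>Word values and verbal subgroups\<close>

definition word_values ::
    "('a, 'b) monoid_scheme \<Rightarrow> nat \<Rightarrow> (nat \<times> bool) list \<Rightarrow> 'a set" where
  "word_values G r w = {word_value G g w | g. g \<in> {1..r} \<rightarrow> carrier G}"

definition closed_subgroup_generated ::
    "('a, 'b) monoid_scheme \<Rightarrow> 'a topology \<Rightarrow> 'a set \<Rightarrow> 'a set" where
  "closed_subgroup_generated G T S = \<Inter>{H. subgroup H G \<and> closedin T H \<and> S \<subseteq> H}"

definition verbal_subgroup ::
    "('a, 'b) monoid_scheme \<Rightarrow> 'a topology \<Rightarrow> nat \<Rightarrow> (nat \<times> bool) list \<Rightarrow> 'a set" where
  "verbal_subgroup G T r w = closed_subgroup_generated G T (word_values G r w)"

end

theory Submission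
  imports Defs "HOL-Algebra.Zassenhaus"
begin

text \<open>
  Call a word map vanishing in a set \<open>K\<close> of variables if it is trivial as soon as one of the
  variables in \<open>K\<close> is \<open>1\<close>. Such a map is a product of commutators that involve all variables in
  \<open>K\<close>, so it is trivial if \<open>card K\<close> exceeds the nilpotency class. Every word map is a product of
  word maps vanishing in all their variables, whose sets of values are again smaller than the
  continuum. For such an \<open>f\<close> with variables in \<open>K\<close>, the derivative
  \<open>f (x y) f (y)\<^sup>-\<^sup>1 f (x)\<^sup>-\<^sup>1\<close> in one variable vanishes in \<open>card K + 1\<close> variables, so by downward
  induction on \<open>card K\<close> its values generate a finite group. By the tube lemma \<open>f\<close> is then
  multiplicative in every variable with respect to factors close to \<open>1\<close>. A compact Hausdorff space
  smaller than the continuum has an isolated point, so \<open>f\<close> is constant on some nonempty open set,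
  and together with multiplicativity and compactness this makes its image finite. As the values of the
  derivative generate a finite group, the values of \<open>f\<close> have finite order, and Dietzmann's lemma shows
  that they generate a finite group.
\<close>


section \<open>Word maps\<close>

context group
begin

lemma inv_mult_cancel:
  assumes "x \<in> carrier G" "y \<in> carrier G"
  shows "inv x \<otimes> (x \<otimes> y) = y" "x \<otimes> (inv x \<otimes> y) = y"
  using assms by (simp_all flip: m_assoc)

text \<open>Assignments are total on \<open>nat\<close>, so that a fresh variable is available
  outside any finite set of variables.\<close>

abbreviation assignments :: "(nat \<Rightarrow> 'a) set" where
  "assignments \<equiv> UNIV \<rightarrow> carrier G"

text \<open>The rule \<open>ext\<close> identifies maps that agree on assignments, because the group
  identities hold only for arguments in the carrier.\<close>

inductive_set pointwise_generate :: "((nat \<Rightarrow> 'a) \<Rightarrow> 'a) set \<Rightarrow> ((nat \<Rightarrow> 'a) \<Rightarrow> 'a) set"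
  for F where
    one: "(\<lambda>g. \<one>) \<in> pointwise_generate F"
  | incl: "f \<in> F \<Longrightarrow> f \<in> pointwise_generate F"
  | inv: "f \<in> pointwise_generate F \<Longrightarrow> (\<lambda>g. inv (f g)) \<in> pointwise_generate F"
  | mult: "\<lbrakk>f \<in> pointwise_generate F; f' \<in> pointwise_generate F\<rbrakk>
      \<Longrightarrow> (\<lambda>g. f g \<otimes> f' g) \<in> pointwise_generate F"
  | ext: "\<lbrakk>f \<in> pointwise_generate F; \<And>g. g \<in> assignments \<Longrightarrow> f' g = f g\<rbrakk>
      \<Longrightarrow> f' \<in> pointwise_generate F"

definition word_maps :: "((nat \<Rightarrow> 'a) \<Rightarrow> 'a) set" where
  "word_maps = pointwise_generate (range (\<lambda>i g. g i))"

lemma pointwise_generate_subgroup: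
  assumes "f \<in> pointwise_generate F" "subgroup H G" "g \<in> assignments"
    and "\<And>f. f \<in> F \<Longrightarrow> f g \<in> H"
  shows "f g \<in> H"
  using assms(1)
  by induction (use assms in \<open>auto intro: subgroup.one_closed subgroup.m_inv_closed subgroup.m_closed\<close>)

lemma pointwise_generate_mono: "F \<subseteq> F' \<Longrightarrow> pointwise_generate F \<subseteq> pointwise_generate F'"
proof
  fix f assume "F \<subseteq> F'" and "f \<in> pointwise_generate F"
  show "f \<in> pointwise_generate F'"
    using \<open>f \<in> pointwise_generate F\<close>
    by induction (use \<open>F \<subseteq> F'\<close> in \<open>auto intro: pointwise_generate.intros\<close>)
qed

lemma pointwise_generate_minimal:
  assumes "F \<subseteq> pointwise_generate F'"
  shows "pointwise_generate F \<subseteq> pointwise_generate F'"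
proof
  fix f assume "f \<in> pointwise_generate F"
  then show "f \<in> pointwise_generate F'"
    by induction (use assms in \<open>auto intro: pointwise_generate.intros\<close>)
qed

lemma word_maps_var: "(\<lambda>g. g i) \<in> word_maps"
  unfolding word_maps_def by (blast intro: pointwise_generate.incl)

lemmas word_maps_one = pointwise_generate.one[of "range (\<lambda>i g. g i)", folded word_maps_def]
lemmas word_maps_inv = pointwise_generate.inv[of _ "range (\<lambda>i g. g i)", folded word_maps_def]
lemmas word_maps_mult = pointwise_generate.mult[of _ "range (\<lambda>i g. g i)", folded word_maps_def]
lemmas word_maps_ext = pointwise_generate.ext[of _ "range (\<lambda>i g. g i)", folded word_maps_def]

lemma word_maps_induct [consumes 1, case_names one var inv mult ext]:
  assumes "f \<in> word_maps"
    and "P (\<lambda>g. \<one>)" "\<And>i. P (\<lambda>g. g i)"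
    and "\<And>f. \<lbrakk>f \<in> word_maps; P f\<rbrakk> \<Longrightarrow> P (\<lambda>g. inv (f g))"
    and "\<And>f f'. \<lbrakk>f \<in> word_maps; P f; f' \<in> word_maps; P f'\<rbrakk> \<Longrightarrow> P (\<lambda>g. f g \<otimes> f' g)"
    and "\<And>f f'. \<lbrakk>f \<in> word_maps; P f; \<And>g. g \<in> assignments \<Longrightarrow> f' g = f g\<rbrakk> \<Longrightarrow> P f'"
  shows "P f"
  using assms(1) unfolding word_maps_def
proof (induction rule: pointwise_generate.induct)
  case one
  show ?case by (rule assms(2))
next
  case (incl f)
  then obtain i where "f = (\<lambda>g. g i)" by blast
  then show ?case using assms(3) by simp
next
  case (inv f)
  then show ?case using assms(4) by (simp add: word_maps_def)
next
  case (mult f f')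
  then show ?case using assms(5) by (simp add: word_maps_def)
next
  case (ext f f')
  show ?case using assms(6)[of f f'] ext by (simp add: word_maps_def)
qed

lemma word_maps_closed:
  "\<lbrakk>f \<in> word_maps; g \<in> assignments\<rbrakk> \<Longrightarrow> f g \<in> carrier G"
  unfolding word_maps_def by (erule pointwise_generate_subgroup[OF _ subgroup_self]) auto

lemma word_maps_word_value: "(\<lambda>g. word_value G g w) \<in> word_maps"
proof (induction w)
  case Nil
  then show ?case by (simp add: word_value_def word_maps_one)
next
  case (Cons a w)
  then show ?case
    by (cases a; cases "snd a")
      (auto simp: word_value_def intro!: word_maps_mult word_maps_inv word_maps_var)
qed

lemma fun_upd_assignment:
  "\<lbrakk>g \<in> assignments; x \<in> carrier G\<rbrakk> \<Longrightarrow> g(i := x) \<in> assignments"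
  by auto

text \<open>Substituting words into words gives words; derivatives and specialisations
  \<open>x_i = 1\<close> are of this kind.\<close>

lemma word_maps_fun_upd:
  assumes "f \<in> word_maps" "u \<in> word_maps"
  shows "(\<lambda>g. f (g(i := u g))) \<in> word_maps"
  using assms(1)
proof (induction rule: word_maps_induct)
  case (var k)
  then show ?case using assms(2) word_maps_var by (cases "k = i") auto
next
  case (ext f f')
  show ?case
  proof (rule word_maps_ext[OF ext.IH])
    fix g assume "g \<in> assignments"
    then have "g(i := u g) \<in> assignments"
      using fun_upd_assignment word_maps_closed[OF assms(2)] by blast
    then show "f' (g(i := u g)) = f (g(i := u g))" by (rule ext.hyps)
  qed
qed (auto intro: word_maps_one word_maps_inv word_maps_mult)

text \<open>Conjugation by \<open>y\<close> is an endomorphism and so commutes with words. Hence the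
  image of a word map is invariant under conjugation, as normality and Dietzmann's lemma
  require.\<close>

lemma word_maps_conj:
  assumes "f \<in> word_maps" "g \<in> assignments" "y \<in> carrier G"
  shows "y \<otimes> f g \<otimes> inv y = f (\<lambda>i. y \<otimes> g i \<otimes> inv y)"
  using assms(1)
proof (induction rule: word_maps_induct)
  case one
  then show ?case using assms by simp
next
  case (var i)
  then show ?case using assms by auto
next
  case (inv f)
  then show ?case using assms word_maps_closed[OF inv(1) assms(2)]
    by (simp add: inv_mult_group m_assoc inv(2)[symmetric])
next
  case (mult f f')
  have "f g \<in> carrier G" "f' g \<in> carrier G" using mult word_maps_closed[OF _ assms(2)] by auto
  then have "y \<otimes> (f g \<otimes> f' g) \<otimes> inv y = (y \<otimes> f g \<otimes> inv y) \<otimes> (y \<otimes> f' g \<otimes> inv y)"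
    using assms(3) by (simp add: m_assoc inv_mult_cancel)
  then show ?case using mult by simp
next
  case (ext f f')
  have "(\<lambda>i. y \<otimes> g i \<otimes> inv y) \<in> assignments" using assms by auto
  then show ?case using ext assms by simp
qed

lemma word_maps_one_assignment: "f \<in> word_maps \<Longrightarrow> f (\<lambda>i. \<one>) = \<one>"
  using pointwise_generate_subgroup[OF _ triv_subgroup, of f "range (\<lambda>i g. g i)" "\<lambda>i. \<one>"]
  by (auto simp: word_maps_def)

section \<open>The lower central series\<close>

lemma subgroup_lower_central: "subgroup (lower_central G n) G"
proof (induction n)
  case (Suc n)
  then show ?case
    by (auto simp: commutator_subgroup_def intro!: generate_is_subgroup dest: subgroup.mem_carrier)
qed (simp add: subgroup_self)

lemma lower_central_Suc_subset: "lower_central G (Suc n) \<subseteq> lower_central G n"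
proof (induction n)
  case 0
  show ?case using subgroup.subset[OF subgroup_lower_central[of "Suc 0"]] by simp
next
  case (Suc n)
  then show ?case
    unfolding lower_central.simps(2)[of G "Suc n"] lower_central.simps(2)[of G n]
      commutator_subgroup_def
    by (intro mono_generate) auto
qed

lemma lower_central_antimono: "m \<le> n \<Longrightarrow> lower_central G n \<subseteq> lower_central G m"
  using lift_Suc_antimono_le[of "lower_central G"] lower_central_Suc_subset by blast

lemma commutator_in_lower_central:
  assumes "x \<in> lower_central G n" "y \<in> carrier G"
  shows "x \<otimes> y \<otimes> inv x \<otimes> inv y \<in> lower_central G (Suc n)"
  using assms by (auto simp: commutator_subgroup_def intro!: generate.incl)

end


section \<open>Words vanishing in many variables\<close>

context group
begin

text \<open>Left-normed commutators whose later entries are variables or their inverses;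
  \<open>S\<close> records the variables that occur. Letters suffice as entries because conjugation
  by a word is iterated conjugation by letters.\<close>

inductive left_normed :: "nat set \<Rightarrow> ((nat \<Rightarrow> 'a) \<Rightarrow> 'a) \<Rightarrow> bool" where
  var: "left_normed {i} (\<lambda>g. g i)"
| comm: "\<lbrakk>left_normed S f; k = (\<lambda>g. g i) \<or> k = (\<lambda>g. inv (g i))\<rbrakk>
    \<Longrightarrow> left_normed (insert i S) (\<lambda>g. f g \<otimes> k g \<otimes> inv (f g) \<otimes> inv (k g))"

definition commutator_maps :: "nat set \<Rightarrow> ((nat \<Rightarrow> 'a) \<Rightarrow> 'a) set" where
  "commutator_maps K = pointwise_generate {f. \<exists>S. K \<subseteq> S \<and> left_normed S f}"

lemma left_normed_word_maps: "left_normed S f \<Longrightarrow> f \<in> word_maps"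
  by (induction rule: left_normed.induct)
    (auto intro!: word_maps_var word_maps_inv word_maps_mult)

text \<open>Each commutation goes one step down the lower central series, while \<open>S\<close>
  grows by at most one element. The index is \<open>card S - 1\<close> since
  \<open>lower_central\<close> counts from 0.\<close>

lemma left_normed_lower_central:
  assumes "left_normed S f"
  shows "finite S \<and> (\<forall>g \<in> assignments. f g \<in> lower_central G (card S - 1))"
  using assms
proof induction
  case (comm S f k i)
  have "card (insert i S) - 1 \<le> Suc (card S - 1)"
    using comm.IH by (auto simp: card_insert_if)
  then have "lower_central G (Suc (card S - 1)) \<subseteq> lower_central G (card (insert i S) - 1)"
    by (rule lower_central_antimono)
  moreover have "k g \<in> carrier G" if "g \<in> assignments" for g
    using that comm.hyps(2) by auto
  ultimately show ?case using comm.IH commutator_in_lower_central by blast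
qed auto

lemma commutator_maps_lower_central:
  assumes "f \<in> commutator_maps K" "g \<in> assignments"
  shows "f g \<in> lower_central G (card K - 1)"
proof (rule pointwise_generate_subgroup[OF _ subgroup_lower_central assms(2)])
  fix f assume "f \<in> {f. \<exists>S. K \<subseteq> S \<and> left_normed S f}"
  then obtain S where S: "K \<subseteq> S" "left_normed S f" by blast
  then have "finite S" using left_normed_lower_central by blast
  then have "card K - 1 \<le> card S - 1" using S card_mono diff_le_mono by blast
  then show "f g \<in> lower_central G (card K - 1)"
    using left_normed_lower_central[OF S(2)] assms(2) lower_central_antimono by blast
qed (use assms in \<open>simp add: commutator_maps_def\<close>)

lemma commutator_maps_word_maps: "commutator_maps K \<subseteq> word_maps"
  unfolding commutator_maps_def word_maps_def
  by (rule pointwise_generate_minimal) (use left_normed_word_maps in \<open>auto simp: word_maps_def\<close>)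

lemma commutator_maps_empty: "commutator_maps {} = word_maps"
proof
  show "word_maps \<subseteq> commutator_maps {}"
    unfolding commutator_maps_def word_maps_def
    by (rule pointwise_generate_mono) (auto intro: left_normed.var)
qed (rule commutator_maps_word_maps)

text \<open>For a generator \<open>f\<close>, \<open>k f k^-1 = [f,k]^-1 f\<close>, and
  \<open>[f,k]\<close> is again left-normed and still involves the variables of \<open>f\<close>.
  Products and inverses follow because conjugation is a homomorphism.\<close>

lemma commutator_maps_conj_letter:
  assumes "f \<in> commutator_maps K" and k: "k = (\<lambda>g. g i) \<or> k = (\<lambda>g. inv (g i))"
  shows "(\<lambda>g. k g \<otimes> f g \<otimes> inv (k g)) \<in> commutator_maps K"
proof -
  have kc: "k g \<in> carrier G" if "g \<in> assignments" for g
    using that k by auto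
  have fc: "f g \<in> carrier G"
    if "f \<in> pointwise_generate {f. \<exists>S. K \<subseteq> S \<and> left_normed S f}" "g \<in> assignments" for f g
    using that commutator_maps_word_maps[of K] word_maps_closed commutator_maps_def by blast
  show ?thesis
    using assms(1) unfolding commutator_maps_def
  proof induction
    case one
    show ?case by (rule pointwise_generate.ext[OF pointwise_generate.one]) (simp add: kc)
  next
    case (incl f)
    then obtain S where S: "K \<subseteq> S" "left_normed S f" by blast
    let ?c = "\<lambda>g. f g \<otimes> k g \<otimes> inv (f g) \<otimes> inv (k g)"
    have "left_normed (insert i S) ?c" using S(2) k by (rule left_normed.comm)
    then have "?c \<in> pointwise_generate {f. \<exists>S. K \<subseteq> S \<and> left_normed S f}"
      using S(1) by (blast intro: pointwise_generate.incl)
    then have "(\<lambda>g. inv (?c g) \<otimes> f g) \<in> pointwise_generate {f. \<exists>S. K \<subseteq> S \<and> left_normed S f}"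
      by (rule pointwise_generate.mult[OF pointwise_generate.inv pointwise_generate.incl[OF incl]])
    then show ?case
    proof (rule pointwise_generate.ext)
      fix g :: "nat \<Rightarrow> 'a" assume g: "g \<in> assignments"
      show "k g \<otimes> f g \<otimes> inv (k g) = inv (?c g) \<otimes> f g"
        using kc[OF g] fc[OF pointwise_generate.incl[OF incl] g]
        by (simp add: inv_mult_group m_assoc inv_mult_cancel)
    qed
  next
    case (inv f)
    show ?case
      by (rule pointwise_generate.ext[OF pointwise_generate.inv[OF inv(2)]])
        (simp add: kc fc[OF inv(1)] inv_mult_group m_assoc inv_mult_cancel)
  next
    case (mult f f')
    show ?case
    proof (rule pointwise_generate.ext[OF pointwise_generate.mult[OF mult(3,4)]])
      fix g :: "nat \<Rightarrow> 'a" assume g: "g \<in> assignments"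
      show "k g \<otimes> (f g \<otimes> f' g) \<otimes> inv (k g) = (k g \<otimes> f g \<otimes> inv (k g)) \<otimes> (k g \<otimes> f' g \<otimes> inv (k g))"
        using kc[OF g] fc[OF mult(1) g] fc[OF mult(2) g]
        by (simp add: m_assoc inv_mult_cancel)
    qed
  next
    case (ext f f')
    show ?case by (rule pointwise_generate.ext[OF ext(3)]) (simp add: ext(2))
  qed
qed

text \<open>Induction on the word \<open>u\<close> from the case of letters. Both directions are
  treated together so that passing from \<open>u\<close> to its inverse merely swaps them.\<close>

lemma commutator_maps_conj:
  assumes "u \<in> word_maps" "f \<in> commutator_maps K"
  shows "(\<lambda>g. u g \<otimes> f g \<otimes> inv (u g)) \<in> commutator_maps K \<and>
    (\<lambda>g. inv (u g) \<otimes> f g \<otimes> u g) \<in> commutator_maps K"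
proof -
  note ext = pointwise_generate.ext[of _ "{f. \<exists>S. K \<subseteq> S \<and> left_normed S f}", folded commutator_maps_def]
  have fc: "f g \<in> carrier G" if "f \<in> commutator_maps K" "g \<in> assignments" for f g
    using that commutator_maps_word_maps[of K] word_maps_closed by blast
  show ?thesis
    using assms
  proof (induction arbitrary: f rule: word_maps_induct)
    case one
    then show ?case by (auto intro!: ext[OF one] simp: fc)
  next
    case (var i)
    have 1: "(\<lambda>g. g i \<otimes> f g \<otimes> inv (g i)) \<in> commutator_maps K"
      using commutator_maps_conj_letter[OF var] by blast
    have "(\<lambda>g. inv (g i) \<otimes> f g \<otimes> inv (inv (g i))) \<in> commutator_maps K"
      using commutator_maps_conj_letter[OF var, of "\<lambda>g. inv (g i)" i] by simp
    then have "(\<lambda>g. inv (g i) \<otimes> f g \<otimes> g i) \<in> commutator_maps K"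
      by (rule ext) (auto simp: inv_inv Pi_def)
    with 1 show ?case by simp
  next
    case (inv u)
    have "(\<lambda>g. inv (u g) \<otimes> f g \<otimes> inv (inv (u g))) \<in> commutator_maps K"
      by (rule ext[OF conjunct2[OF inv.IH[OF inv.prems]]]) (simp add: word_maps_closed[OF inv.hyps])
    moreover have "(\<lambda>g. inv (inv (u g)) \<otimes> f g \<otimes> inv (u g)) \<in> commutator_maps K"
      by (rule ext[OF conjunct1[OF inv.IH[OF inv.prems]]]) (simp add: word_maps_closed[OF inv.hyps])
    ultimately show ?case by simp
  next
    case (mult u u')
    note c = word_maps_closed[OF mult.hyps(1)] word_maps_closed[OF mult.hyps(2)] fc[OF mult.prems]
    have "(\<lambda>g. (u g \<otimes> u' g) \<otimes> f g \<otimes> inv (u g \<otimes> u' g)) \<in> commutator_maps K"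
      by (rule ext[OF conjunct1[OF mult.IH(1)[OF conjunct1[OF mult.IH(2)[OF mult.prems]]]]])
        (simp add: c inv_mult_group m_assoc inv_mult_cancel)
    moreover have "(\<lambda>g. inv (u g \<otimes> u' g) \<otimes> f g \<otimes> (u g \<otimes> u' g)) \<in> commutator_maps K"
      by (rule ext[OF conjunct2[OF mult.IH(2)[OF conjunct2[OF mult.IH(1)[OF mult.prems]]]]])
        (simp add: c inv_mult_group m_assoc inv_mult_cancel)
    ultimately show ?case by simp
  next
    case (ext u u')
    note IH = ext.IH[OF ext.prems]
    show ?case
      using pointwise_generate.ext[OF IH[THEN conjunct1, unfolded commutator_maps_def]]
        pointwise_generate.ext[OF IH[THEN conjunct2, unfolded commutator_maps_def]]
      by (simp add: commutator_maps_def ext.hyps(2))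
  qed
qed

section \<open>Splitting off the part that vanishes in one more variable\<close>

lemma left_normed_fun_upd: "\<lbrakk>left_normed S f; i \<notin> S\<rbrakk> \<Longrightarrow> f (g(i := x)) = f g"
  by (induction rule: left_normed.induct) auto

lemma left_normed_one:
  "\<lbrakk>left_normed S f; i \<in> S; g \<in> assignments\<rbrakk> \<Longrightarrow> f (g(i := \<one>)) = \<one>"
proof (induction rule: left_normed.induct)
  case (comm S f k j)
  have g1: "g(i := \<one>) \<in> assignments" using comm.prems by auto
  have c: "f (g(i := \<one>)) \<in> carrier G" "k (g(i := \<one>)) \<in> carrier G"
    using word_maps_closed[OF left_normed_word_maps[OF comm.hyps(1)] g1] comm.hyps(2) g1 by auto
  show ?case
  proof (cases "i \<in> S")
    case True
    then have "f (g(i := \<one>)) = \<one>" using comm by blast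
    then show ?thesis using c by (simp del: fun_upd_apply)
  next
    case False
    then have "k (g(i := \<one>)) = \<one>" using comm by auto
    then show ?thesis using c by (simp del: fun_upd_apply)
  qed
qed auto

lemma commutator_maps_one:
  assumes "f \<in> commutator_maps K" "i \<in> K" "g \<in> assignments"
  shows "f (g(i := \<one>)) = \<one>"
proof -
  have "f (g(i := \<one>)) \<in> {\<one>}"
  proof (rule pointwise_generate_subgroup[where f = f and g = "g(i := \<one>)", OF _ triv_subgroup])
    show "f \<in> pointwise_generate {f. \<exists>S. K \<subseteq> S \<and> left_normed S f}"
      using assms(1) by (simp add: commutator_maps_def)
  qed (use assms left_normed_one fun_upd_assignment in blast)+
  then show ?thesis by simp
qed

text \<open>A generator involving \<open>i\<close> goes into \<open>h\<close>, any other into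
  \<open>v\<close>. Products are sorted by \<open>h v h' v' = h (v h' v^-1) (v v')\<close>, where
  the conjugate stays in \<open>commutator_maps (insert i K)\<close>.\<close>

lemma commutator_maps_split:
  assumes "f \<in> commutator_maps K"
  shows "\<exists>h \<in> commutator_maps (insert i K). \<exists>v \<in> word_maps. (\<forall>g x. v (g(i := x)) = v g) \<and>
    (\<forall>g \<in> assignments. f g = h g \<otimes> v g)"
proof -
  note rules = pointwise_generate.intros[where F = "{f. \<exists>S. insert i K \<subseteq> S \<and> left_normed S f}",
      folded commutator_maps_def]
  have hc: "h g \<in> carrier G" if "h \<in> commutator_maps (insert i K)" "g \<in> assignments" for h g
    using that commutator_maps_word_maps word_maps_closed by blast
  show ?thesis
    using assms unfolding commutator_maps_def[of K]
  proof induction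
    case one
    show ?case by (rule bexI[OF _ rules(1)], rule bexI[OF _ word_maps_one]) simp
  next
    case (incl f)
    then obtain S where S: "K \<subseteq> S" "left_normed S f" by blast
    note f = left_normed_word_maps[OF S(2)]
    show ?case
    proof (cases "i \<in> S")
      case True
      then have "f \<in> commutator_maps (insert i K)" using S by (intro rules(2)) auto
      then show ?thesis
        by (rule bexI[rotated], intro bexI[OF _ word_maps_one]) (simp add: word_maps_closed[OF f])
    next
      case False
      show ?thesis
        by (rule bexI[OF _ rules(1)], rule bexI[OF _ f])
          (simp add: word_maps_closed[OF f] left_normed_fun_upd[OF S(2) False] del: fun_upd_apply)
    qed
  next
    case (inv f)
    then obtain h v where hv: "h \<in> commutator_maps (insert i K)" "v \<in> word_maps"
      "\<forall>g x. v (g(i := x)) = v g" "\<forall>g \<in> assignments. f g = h g \<otimes> v g" by blast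
    have "(\<lambda>g. inv (v g) \<otimes> inv (h g) \<otimes> v g) \<in> commutator_maps (insert i K)"
      using commutator_maps_conj[OF hv(2) rules(3)[OF hv(1)]] by blast
    then show ?case
      by (rule bexI[rotated], intro bexI[OF _ word_maps_inv[OF hv(2)]])
        (simp add: hv(3,4) inv_mult_group m_assoc inv_mult_cancel hc[OF hv(1)] word_maps_closed[OF hv(2)]
            del: fun_upd_apply)
  next
    case (mult f f')
    then obtain h v h' v' where hv: "h \<in> commutator_maps (insert i K)" "v \<in> word_maps"
      "\<forall>g x. v (g(i := x)) = v g" "\<forall>g \<in> assignments. f g = h g \<otimes> v g"
      and hv': "h' \<in> commutator_maps (insert i K)" "v' \<in> word_maps"
      "\<forall>g x. v' (g(i := x)) = v' g" "\<forall>g \<in> assignments. f' g = h' g \<otimes> v' g" by blast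
    have "(\<lambda>g. h g \<otimes> (v g \<otimes> h' g \<otimes> inv (v g))) \<in> commutator_maps (insert i K)"
      using commutator_maps_conj[OF hv(2) hv'(1)] rules(4)[OF hv(1)] by blast
    then show ?case
      by (rule bexI[rotated], intro bexI[OF _ word_maps_mult[OF hv(2) hv'(2)]])
        (simp add: hv(3,4) hv'(3,4) m_assoc inv_mult_cancel hc[OF hv(1)] hc[OF hv'(1)]
            word_maps_closed[OF hv(2)] word_maps_closed[OF hv'(2)] del: fun_upd_apply)
  next
    case (ext f f')
    then show ?case by auto
  qed
qed

text \<open>
  \<open>f\<close> is split as \<open>h v\<close> with \<open>h\<close> trivial at \<open>x\<^sub>i = 1\<close> and \<open>v\<close> independent of \<open>x\<^sub>i\<close>; if \<open>f\<close> is
  trivial at \<open>x\<^sub>i = 1\<close>, then so is \<open>v\<close>, hence \<open>v\<close> is trivial everywhere.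
\<close>

lemma vanishing_commutator_maps:
  assumes "finite K" "f \<in> word_maps"
    and "\<And>i g. \<lbrakk>i \<in> K; g \<in> assignments\<rbrakk> \<Longrightarrow> f (g(i := \<one>)) = \<one>"
  shows "f \<in> commutator_maps K"
  using assms
proof (induction K)
  case empty
  then show ?case by (simp add: commutator_maps_empty)
next
  case (insert i K)
  then have "f \<in> commutator_maps K" by blast
  then obtain h v where hv: "h \<in> commutator_maps (insert i K)" "v \<in> word_maps"
    "\<forall>g x. v (g(i := x)) = v g" "\<forall>g \<in> assignments. f g = h g \<otimes> v g"
    using commutator_maps_split by blast
  show ?case
    unfolding commutator_maps_def
  proof (rule pointwise_generate.ext[OF hv(1)[unfolded commutator_maps_def]])
    fix g :: "nat \<Rightarrow> 'a" assume g: "g \<in> assignments"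
    note g1 = fun_upd_assignment[OF g one_closed, of i]
    have "\<one> = h (g(i := \<one>)) \<otimes> v (g(i := \<one>))"
      using insert.prems(2)[OF _ g] hv(4) g1 by (metis insertI1)
    then have "v g = \<one>"
      using commutator_maps_one[OF hv(1) _ g] hv(3) word_maps_closed[OF hv(2) g] by simp
    then show "f g = h g"
      using hv(4) g word_maps_closed[OF subsetD[OF commutator_maps_word_maps hv(1)] g] by simp
  qed
qed

text \<open>Vanishing in \<open>K\<close> puts the values into
  \<open>lower_central G (card K - 1)\<close>; the strict bound on \<open>c\<close> compensates for
  the \<open>- 1\<close>.\<close>

lemma vanishing_trivial:
  assumes "finite K" "c < card K" "lower_central G c = {\<one>}"
    and "f \<in> word_maps" "\<And>i g. \<lbrakk>i \<in> K; g \<in> assignments\<rbrakk> \<Longrightarrow> f (g(i := \<one>)) = \<one>"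
    and "g \<in> assignments"
  shows "f g = \<one>"
proof -
  have "f g \<in> lower_central G (card K - 1)"
    by (rule commutator_maps_lower_central[OF vanishing_commutator_maps[OF assms(1,4,5)] assms(6)])
  moreover have "c \<le> card K - 1" using assms(2) by linarith
  ultimately have "f g \<in> lower_central G c" using lower_central_antimono by blast
  then show ?thesis by (simp only: assms(3) singleton_iff)
qed

end


section \<open>Small sets and Dietzmann's lemma\<close>

text \<open>Unless both sets are finite, the larger one is infinite, hence equipotent to its square,
  and this square bounds the product.\<close>

lemma lesspoll_Times:
  assumes "infinite C" "A \<prec> C" "B \<prec> C"
  shows "A \<times> B \<prec> C"
proof (cases "finite A \<and> finite B")
  case True
  then show ?thesis using assms(1) by (simp add: finite_lesspoll_infinite)
next
  case False
  have square: "D \<times> D \<approx> D" if "infinite D" for D :: "'x set"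
    using card_of_Times_same_infinite[OF that] by (simp add: eqpoll_iff_card_of_ordIso)
  have "A \<lesssim> B \<or> B \<lesssim> A"
    using ordLeq_total[OF card_of_Well_order card_of_Well_order, of A B]
    by (simp add: lepoll_def card_of_ordLeq)
  then show ?thesis
  proof
    assume AB: "A \<lesssim> B"
    then have "infinite B" using False by (auto simp: lepoll_def dest: inj_on_finite)
    have "A \<times> B \<lesssim> B \<times> B" using AB by (simp add: times_lepoll_mono)
    also have "B \<times> B \<approx> B" using \<open>infinite B\<close> by (rule square)
    finally show ?thesis using assms(3) by (rule lesspoll_trans1)
  next
    assume BA: "B \<lesssim> A"
    then have "infinite A" using False by (auto simp: lepoll_def dest: inj_on_finite)
    have "A \<times> B \<lesssim> A \<times> A" using BA by (simp add: times_lepoll_mono)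
    also have "A \<times> A \<approx> A" using \<open>infinite A\<close> by (rule square)
    finally show ?thesis using assms(2) by (rule lesspoll_trans1)
  qed
qed

lemma infinite_nat_sets: "infinite (UNIV :: nat set set)"
  using finite_Pow_iff[of "UNIV :: nat set"] by simp

context group
begin

section \<open>Products in a finite conjugation-invariant set of torsion elements\<close>

lemma foldr_mult_closed:
  "set xs \<subseteq> carrier G \<Longrightarrow> foldr (\<otimes>) xs \<one> \<in> carrier G"
  by (induction xs) auto

lemma foldr_mult_append:
  "\<lbrakk>set xs \<subseteq> carrier G; set ys \<subseteq> carrier G\<rbrakk>
    \<Longrightarrow> foldr (\<otimes>) (xs @ ys) \<one> = foldr (\<otimes>) xs \<one> \<otimes> foldr (\<otimes>) ys \<one>"
  by (induction xs) (auto simp: foldr_mult_closed m_assoc)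

text \<open>Moving \<open>s^k\<close> to the front past a factor \<open>a\<close> turns
  \<open>a\<close> into its conjugate \<open>s^-k a s^k\<close>, which stays in \<open>S\<close>, so
  the number of factors is preserved.\<close>

lemma foldr_mult_collect:
  assumes "S \<subseteq> carrier G" "\<And>s y. \<lbrakk>s \<in> S; y \<in> carrier G\<rbrakk> \<Longrightarrow> y \<otimes> s \<otimes> inv y \<in> S"
    and "s \<in> S" "set xs \<subseteq> S" "k \<le> count_list xs s"
  shows "\<exists>ys. set ys \<subseteq> S \<and> length ys + k = length xs \<and>
    foldr (\<otimes>) xs \<one> = s [^] k \<otimes> foldr (\<otimes>) ys \<one>"
  using assms(4,5)
proof (induction xs arbitrary: k)
  case Nil
  then show ?case by simp
next
  case (Cons a xs)
  have a: "a \<in> S" "a \<in> carrier G" and s: "s \<in> carrier G" using Cons.prems assms(1,3) by auto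
  show ?case
  proof (cases k)
    case 0
    then show ?thesis
      using Cons.prems a foldr_mult_closed[of xs] assms(1) by (intro exI[of _ "a # xs"]) auto
  next
    case (Suc k')
    show ?thesis
    proof (cases "a = s")
      case True
      then obtain ys where ys: "set ys \<subseteq> S" "length ys + k' = length xs"
        "foldr (\<otimes>) xs \<one> = s [^] k' \<otimes> foldr (\<otimes>) ys \<one>"
        using Cons.IH[of k'] Cons.prems Suc by auto
      have "foldr (\<otimes>) ys \<one> \<in> carrier G" using foldr_mult_closed ys(1) assms(1) by blast
      then have "foldr (\<otimes>) (a # xs) \<one> = s [^] k \<otimes> foldr (\<otimes>) ys \<one>"
        using True Suc ys(3) s by (simp add: m_assoc[symmetric] nat_pow_comm[of s k' 1, simplified])
      then show ?thesis using ys Suc by auto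
    next
      case False
      then obtain ys where ys: "set ys \<subseteq> S" "length ys + k = length xs"
        "foldr (\<otimes>) xs \<one> = s [^] k \<otimes> foldr (\<otimes>) ys \<one>"
        using Cons.IH[of k] Cons.prems by auto
      define b where "b = inv (s [^] k) \<otimes> a \<otimes> s [^] k"
      have "b \<in> S" using assms(2)[OF a(1), of "inv (s [^] k)"] s by (simp add: b_def)
      moreover have "foldr (\<otimes>) ys \<one> \<in> carrier G" using foldr_mult_closed ys(1) assms(1) by blast
      ultimately show ?thesis
        using ys a s by (intro exI[of _ "b # ys"]) (auto simp: b_def m_assoc inv_mult_cancel)
    qed
  qed
qed

text \<open>
  Dietzmann's lemma: a product of more than \<open>\<Sum>s\<in>S. n s\<close> factors contains some \<open>s\<close> at least
  \<open>n s\<close> times; these factors can be collected at the front, where they cancel.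
\<close>

lemma finite_generate_torsion:
  assumes S: "finite S" "S \<subseteq> carrier G"
    and conj: "\<And>s y. \<lbrakk>s \<in> S; y \<in> carrier G\<rbrakk> \<Longrightarrow> y \<otimes> s \<otimes> inv y \<in> S"
    and torsion: "\<And>s. s \<in> S \<Longrightarrow> \<exists>n>0. s [^] (n :: nat) = \<one>"
  shows "finite (generate G S)"
proof -
  obtain n :: "'a \<Rightarrow> nat" where n: "\<And>s. s \<in> S \<Longrightarrow> 0 < n s \<and> s [^] n s = \<one>"
    using torsion by metis
  let ?N = "\<Sum>s\<in>S. n s"
  \<comment> \<open>Cancelling repeatedly shortens every product to at most \<open>?N\<close>
    factors, and there are only finitely many such products.\<close>
  have short: "\<exists>ys. set ys \<subseteq> S \<and> length ys \<le> ?N \<and> foldr (\<otimes>) xs \<one> = foldr (\<otimes>) ys \<one>"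
    if "set xs \<subseteq> S" for xs
    using that
  proof (induction xs rule: length_induct)
    case (1 xs)
    show ?case
    proof (cases "length xs \<le> ?N")
      case True
      then show ?thesis using 1 by blast
    next
      case False
      have "\<exists>s\<in>S. n s \<le> count_list xs s"
      proof (rule ccontr)
        assume "\<not> ?thesis"
        then have "(\<Sum>s\<in>S. count_list xs s) \<le> ?N" by (intro sum_mono) force
        then show False using False sum_count_set[OF 1(2) S(1)] by simp
      qed
      then obtain s where s: "s \<in> S" "n s \<le> count_list xs s" by blast
      obtain ys where ys: "set ys \<subseteq> S" "length ys + n s = length xs"
        "foldr (\<otimes>) xs \<one> = s [^] n s \<otimes> foldr (\<otimes>) ys \<one>"
        using foldr_mult_collect[OF S(2) conj s(1) 1(2) s(2)] by blast
      then have "foldr (\<otimes>) xs \<one> = foldr (\<otimes>) ys \<one>"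
        using n[OF s(1)] foldr_mult_closed[of ys] S(2) by auto
      moreover have "length ys < length xs" using ys(2) n[OF s(1)] by linarith
      ultimately show ?thesis using 1(1) ys(1) by simp
    qed
  qed
  have "\<exists>xs. set xs \<subseteq> S \<and> x = foldr (\<otimes>) xs \<one>" if "x \<in> generate G S" for x
    using that
  proof induction
    case one
    show ?case by (rule exI[of _ "[]"]) simp
  next
    case (incl h)
    then show ?case using S by (intro exI[of _ "[h]"]) auto
  next
    case (inv h)
    then have h: "h \<in> carrier G" using S by auto
    have "foldr (\<otimes>) (replicate k h) \<one> = h [^] k" for k
    proof (induction k)
      case (Suc k)
      then show ?case using nat_pow_Suc2[OF h, of k] by simp
    qed simp
    \<comment> \<open>As \<open>h\<close> has finite order, its inverse is a nonnegative power, so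
      lists of elements of \<open>S\<close> without inverses suffice.\<close>
    moreover have "inv h = h [^] (n h - 1)"
    proof (rule inv_equality)
      have "h [^] (n h - 1) \<otimes> h = h [^] Suc (n h - 1)" by simp
      then show "h [^] (n h - 1) \<otimes> h = \<one>" using n[OF inv] by simp
    qed (use h in auto)
    ultimately show ?case using inv by (intro exI[of _ "replicate (n h - 1) h"]) auto
  next
    case (eng x y)
    then obtain xs ys where "set xs \<subseteq> S" "x = foldr (\<otimes>) xs \<one>" "set ys \<subseteq> S" "y = foldr (\<otimes>) ys \<one>"
      by blast
    then show ?case using foldr_mult_append[of xs ys] S by (intro exI[of _ "xs @ ys"]) auto
  qed
  then have "generate G S \<subseteq> (\<lambda>xs. foldr (\<otimes>) xs \<one>) ` {xs. set xs \<subseteq> S \<and> length xs \<le> ?N}"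
    using short by blast
  then show ?thesis
    using finite_lists_length_le[OF S(1)] finite_surj by blast
qed

text \<open>Two powers coincide by the pigeonhole principle, and the smaller one cancels.\<close>

lemma torsion_if_finite_powers:
  assumes "s \<in> carrier G" "finite (range (\<lambda>n::nat. s [^] n))"
  shows "\<exists>n>0. s [^] (n :: nat) = \<one>"
proof -
  have "\<not> inj (\<lambda>n::nat. s [^] n)" using assms(2) finite_imageD infinite_UNIV_nat by blast
  then obtain m n :: nat where "m < n" "s [^] m = s [^] n"
    by (metis injI linorder_neqE_nat)
  then have "s [^] m \<otimes> s [^] (n - m) = s [^] m \<otimes> \<one>"
    using assms(1) nat_pow_mult[OF assms(1), of m "n - m"] by simp
  then have "inv (s [^] m) \<otimes> (s [^] m \<otimes> s [^] (n - m)) = inv (s [^] m) \<otimes> (s [^] m \<otimes> \<one>)"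
    by (rule arg_cong)
  then have "s [^] (n - m) = \<one>" using assms(1) by (simp only: inv_mult_cancel nat_pow_closed one_closed)
  then show ?thesis using \<open>m < n\<close> by (intro exI[of _ "n - m"]) simp
qed

text \<open>The image of \<open>f0\<close> is closed under conjugation, so it generates a normal
  subgroup. Its product with the subgroup generated by the values of \<open>f1\<close> is then a
  finite subgroup containing the values of \<open>f\<close>.\<close>

lemma finite_generate_mult:
  assumes f0: "f0 \<in> word_maps" and f1: "f1 \<in> word_maps"
    and fin: "finite (generate G (f0 ` assignments))" "finite (generate G (f1 ` assignments))"
    and f: "\<And>g. g \<in> assignments \<Longrightarrow> f g = f0 g \<otimes> f1 g"
  shows "finite (generate G (f ` assignments))"
proof -
  have c: "f0 ` assignments \<subseteq> carrier G" "f1 ` assignments \<subseteq> carrier G"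
    using word_maps_closed f0 f1 by auto
  have "generate G (f0 ` assignments) \<lhd> G"
  proof (rule normal_generateI[OF c(1)])
    fix x y assume "x \<in> f0 ` assignments" "y \<in> carrier G"
    then obtain g where g: "x = f0 g" "g \<in> assignments" by blast
    then have "(\<lambda>i. y \<otimes> g i \<otimes> inv y) \<in> assignments" using \<open>y \<in> carrier G\<close> by auto
    then show "y \<otimes> x \<otimes> inv y \<in> f0 ` assignments"
      using word_maps_conj[OF f0 g(2) \<open>y \<in> carrier G\<close>] g(1) by blast
  qed
  then have "subgroup (generate G (f0 ` assignments) <#> generate G (f1 ` assignments)) G"
    using generate_is_subgroup[OF c(2)] by (rule mult_norm_subgroup)
  moreover have "f ` assignments \<subseteq> generate G (f0 ` assignments) <#> generate G (f1 ` assignments)"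
    by (auto simp: set_mult_def f intro!: generate.incl bexI)
  ultimately have "generate G (f ` assignments)
      \<subseteq> generate G (f0 ` assignments) <#> generate G (f1 ` assignments)"
    by (rule generate_subgroup_incl[rotated])
  moreover have "finite (generate G (f0 ` assignments) <#> generate G (f1 ` assignments))"
    using fin by (auto simp: set_mult_def)
  ultimately show ?thesis by (rule finite_subset)
qed

text \<open>There are fewer than continuum many pairs from two sets smaller than the continuum. The
  operation \<open>p\<close> is left open so that quotients are covered too.\<close>

lemma lesspoll_mult_image:
  assumes "f ` A \<prec> (UNIV :: nat set set)" "f' ` B \<prec> (UNIV :: nat set set)"
    and "\<And>x. x \<in> C \<Longrightarrow> \<exists>a\<in>A. \<exists>b\<in>B. h x = p (f a) (f' b)"
  shows "h ` C \<prec> (UNIV :: nat set set)"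
proof -
  have "h ` C \<subseteq> (\<lambda>(x, y). p x y) ` (f ` A \<times> f' ` B)" using assms(3) by force
  then have "h ` C \<lesssim> f ` A \<times> f' ` B" by (rule subset_image_lepoll)
  also have "\<dots> \<prec> (UNIV :: nat set set)"
    by (rule lesspoll_Times[OF infinite_nat_sets assms(1,2)])
  finally show ?thesis .
qed

end


section \<open>Derivatives\<close>

context group
begin

definition depends_on :: "((nat \<Rightarrow> 'a) \<Rightarrow> 'a) \<Rightarrow> nat set \<Rightarrow> bool" where
  "depends_on f I \<longleftrightarrow>
     (\<forall>g\<in>assignments. \<forall>g'\<in>assignments. (\<forall>i\<in>I. g i = g' i) \<longrightarrow> f g = f g')"

lemma depends_onD:
  "\<lbrakk>depends_on f I; g \<in> assignments; g' \<in> assignments; \<And>i. i \<in> I \<Longrightarrow> g i = g' i\<rbrakk> \<Longrightarrow> f g = f g'"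
  unfolding depends_on_def by blast

lemma depends_on_word_value:
  assumes "fst ` set w \<subseteq> I"
  shows "depends_on (\<lambda>g. word_value G g w) I"
proof -
  have "word_value G g w = word_value G g' w" if "\<And>i. i \<in> I \<Longrightarrow> g i = g' i" for g g'
    using assms
  proof (induction w)
    case (Cons a w)
    then have "g (fst a) = g' (fst a)" "word_value G g w = word_value G g' w"
      using that by simp_all
    then show ?case by (cases a) (simp add: word_value_def)
  qed (simp add: word_value_def)
  then show ?thesis unfolding depends_on_def by blast
qed

text \<open>The second argument of the derivative in the variable \<open>i\<close> is passed in the variable \<open>j\<close>.\<close>

definition derivative :: "((nat \<Rightarrow> 'a) \<Rightarrow> 'a) \<Rightarrow> nat \<Rightarrow> nat \<Rightarrow> (nat \<Rightarrow> 'a) \<Rightarrow> 'a" where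
  "derivative f i j = (\<lambda>g. f (g(i := g i \<otimes> g j)) \<otimes> inv (f (g(i := g j))) \<otimes> inv (f g))"

lemma derivative_word_maps: "f \<in> word_maps \<Longrightarrow> derivative f i j \<in> word_maps"
  unfolding derivative_def
  by (intro word_maps_mult word_maps_inv word_maps_fun_upd word_maps_var)

lemma derivative_depends_on:
  assumes "depends_on f K" "i \<in> K"
  shows "depends_on (derivative f i j) (insert j K)"
  unfolding depends_on_def
proof (intro ballI impI)
  fix g g' assume g: "g \<in> assignments" "g' \<in> assignments" "\<forall>k\<in>insert j K. g k = g' k"
  then have "g i \<in> carrier G" "g j \<in> carrier G" "g' i = g i" "g' j = g j" using assms(2) by auto
  moreover have "f (g(i := x)) = f (g'(i := x))" if "x \<in> carrier G" for x
    by (rule depends_onD[OF assms(1)]) (use g that in auto)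
  moreover have "f g = f g'" by (rule depends_onD[OF assms(1)]) (use g in auto)
  ultimately show "derivative f i j g = derivative f i j g'"
    by (simp add: derivative_def del: fun_upd_apply)
qed

text \<open>Let \<open>x\<close>, \<open>y\<close> be the values of the variables \<open>i\<close>,
  \<open>j\<close>. If one of them is \<open>1\<close>, two of the three factors cancel and the
  remaining one is a value of \<open>f\<close> with a trivial variable; if another variable of
  \<open>K\<close> is \<open>1\<close>, all three factors are trivial. Thus the fresh
  \<open>j\<close> adds one to the number of vanishing variables.\<close>

lemma derivative_vanishing:
  assumes f: "f \<in> word_maps" "depends_on f K" "i \<in> K" "j \<notin> K"
    and vanish: "\<And>k g. \<lbrakk>k \<in> K; g \<in> assignments\<rbrakk> \<Longrightarrow> f (g(k := \<one>)) = \<one>"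
    and k: "k \<in> insert j K" and g: "g \<in> assignments"
  shows "derivative f i j (g(k := \<one>)) = \<one>"
proof -
  have ne: "i \<noteq> j" using f by auto
  have c: "g i \<in> carrier G" "g j \<in> carrier G" using g by auto
  have fc: "f g \<in> carrier G" if "g \<in> assignments" for g using word_maps_closed[OF f(1) that] .
  consider "k = j" | "k = i" | "k \<in> K" "k \<noteq> i" "k \<noteq> j" using k by auto
  then show ?thesis
  proof cases
    case 1
    have "f (g(j := \<one>, i := \<one>)) = \<one>" using vanish[OF f(3)] fun_upd_assignment[OF g one_closed] by blast
    moreover have "(g(j := \<one>))(i := g i) = g(j := \<one>)" using ne by auto
    ultimately show ?thesis
      using 1 ne c fc[OF fun_upd_assignment[OF g one_closed]] by (simp add: derivative_def)
  next
    case 2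
    have "f (g(i := \<one>)) = \<one>" by (rule vanish[OF f(3) g])
    then show ?thesis
      using 2 ne c fc[OF fun_upd_assignment[OF g c(2)]] by (simp add: derivative_def)
  next
    case 3
    have "f (g(k := \<one>, i := x)) = \<one>" if "x \<in> carrier G" for x
      using vanish[OF 3(1) fun_upd_assignment[OF g that, of i]] 3(2) by (simp add: fun_upd_twist)
    then show ?thesis using 3 c vanish[OF 3(1) g] by (simp add: derivative_def)
  qed
qed

lemma derivative_lesspoll:
  assumes f: "f ` assignments \<prec> (UNIV :: nat set set)"
  shows "derivative f i j ` assignments \<prec> (UNIV :: nat set set)"
proof -
  have "(\<lambda>g. f (g(i := g i \<otimes> g j)) \<otimes> inv (f (g(i := g j)))) ` assignments \<prec> (UNIV :: nat set set)"
  proof (rule lesspoll_mult_image[OF f f])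
    fix g assume "g \<in> assignments"
    then have "g i \<in> carrier G" "g j \<in> carrier G" by auto
    then show "\<exists>a\<in>assignments. \<exists>b\<in>assignments.
        f (g(i := g i \<otimes> g j)) \<otimes> inv (f (g(i := g j))) = f a \<otimes> inv (f b)"
      using fun_upd_assignment[OF \<open>g \<in> assignments\<close>] by blast
  qed
  then show ?thesis
    by (rule lesspoll_mult_image[OF _ f]) (auto simp: derivative_def)
qed

text \<open>As \<open>j\<close> lies outside \<open>K\<close>, storing \<open>y\<close> there does
  not affect \<open>f\<close>, so the derivative evaluates to
  \<open>f (x y) f (y)^-1 f (x)^-1\<close>.\<close>

lemma derivative_expand:
  assumes f: "f \<in> word_maps" "depends_on f K" "i \<in> K" "j \<notin> K"
    and g: "g \<in> assignments" and xy: "x \<in> carrier G" "y \<in> carrier G"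
  shows "f (g(i := x \<otimes> y)) = derivative f i j (g(i := x, j := y)) \<otimes> f (g(i := x)) \<otimes> f (g(i := y))"
proof -
  have ne: "i \<noteq> j" using f by auto
  have j: "f (h(j := y)) = f h" if "h \<in> assignments" for h
    by (rule depends_onD[OF f(2)]) (use that f(4) xy in auto)
  let ?g = "g(i := x, j := y)"
  have "?g(i := z) = g(i := z, j := y)" for z using ne by auto
  then have "f (?g(i := z)) = f (g(i := z))" if "z \<in> carrier G" for z
    using j[OF fun_upd_assignment[OF g that]] by simp
  moreover have "f ?g = f (g(i := x))" using j[OF fun_upd_assignment[OF g xy(1)]] by simp
  ultimately have "derivative f i j ?g = f (g(i := x \<otimes> y)) \<otimes> inv (f (g(i := y))) \<otimes> inv (f (g(i := x)))"
    using ne xy by (simp add: derivative_def)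
  moreover have "f (g(i := z)) \<in> carrier G" if "z \<in> carrier G" for z
    using word_maps_closed[OF f(1) fun_upd_assignment[OF g that]] .
  ultimately show ?thesis using xy by (simp add: m_assoc inv_mult_cancel del: fun_upd_apply)
qed

text \<open>
  Modulo the values of the derivative, \<open>f\<close> is a homomorphism in the variable \<open>i\<close>. Hence the powers
  of a value of \<open>f\<close> are, up to finitely many factors, again values of \<open>f\<close>.
\<close>

lemma torsion_values:
  assumes f: "f \<in> word_maps" "depends_on f K" "i \<in> K" "j \<notin> K"
    and vanish: "\<And>g. g \<in> assignments \<Longrightarrow> f (g(i := \<one>)) = \<one>"
    and fin: "finite (f ` assignments)" "finite (generate G (derivative f i j ` assignments))"
    and g: "g \<in> assignments"
  shows "\<exists>n>0. f g [^] (n :: nat) = \<one>"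
proof (rule torsion_if_finite_powers)
  let ?V = "generate G (derivative f i j ` assignments)"
  have D: "derivative f i j ` assignments \<subseteq> carrier G"
    using word_maps_closed[OF derivative_word_maps[OF f(1)]] by auto
  have V: "v \<in> carrier G" if "v \<in> ?V" for v using generate_in_carrier[OF D that] .
  show s: "f g \<in> carrier G" by (rule word_maps_closed[OF f(1) g])
  have x: "g i \<in> carrier G" using g by auto
  have *: "\<exists>v\<in>?V. f (g(i := g i [^] n)) = v \<otimes> f g [^] n" for n :: nat
  proof (induction n)
    case 0
    then show ?case by (intro bexI[OF _ generate.one]) (simp add: vanish[OF g] del: fun_upd_apply)
  next
    case (Suc n)
    then obtain v where v: "v \<in> ?V" "f (g(i := g i [^] n)) = v \<otimes> f g [^] n" by blast
    let ?d = "derivative f i j (g(i := g i [^] n, j := g i))"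
    have d: "?d \<in> ?V"
      using fun_upd_assignment g x by (intro generate.incl imageI) (simp del: fun_upd_apply)
    \<comment> \<open>All correction factors stand on the left, so they combine to
      \<open>?d \<otimes> v\<close> without any conjugation.\<close>
    have "f (g(i := g i [^] Suc n)) = ?d \<otimes> (v \<otimes> f g [^] n) \<otimes> f g"
      using derivative_expand[OF f g, of "g i [^] n" "g i"] x v(2) by simp
    then have "f (g(i := g i [^] Suc n)) = (?d \<otimes> v) \<otimes> f g [^] Suc n"
      using V[OF d] V[OF v(1)] s by (simp add: m_assoc)
    then show ?case using generate.eng[OF d v(1)] by blast
  qed
  have "f g [^] n \<in> (\<lambda>(v, y). inv v \<otimes> y) ` (?V \<times> f ` assignments)" for n :: nat
  proof -
    obtain v where v: "v \<in> ?V" "f (g(i := g i [^] n)) = v \<otimes> f g [^] n" using * by blast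
    then have "f g [^] n = inv v \<otimes> f (g(i := g i [^] n))"
      using V[OF v(1)] s by (simp add: inv_mult_cancel)
    moreover have "g(i := g i [^] n) \<in> assignments" using fun_upd_assignment[OF g] x by simp
    ultimately show ?thesis using v(1) by force
  qed
  then have "range (\<lambda>n::nat. f g [^] n) \<subseteq> (\<lambda>(v, y). inv v \<otimes> y) ` (?V \<times> f ` assignments)"
    by blast
  then show "finite (range (\<lambda>n::nat. f g [^] n))"
    by (rule finite_subset) (intro finite_imageI finite_cartesian_product fin)
qed

end


section \<open>Word maps on compact groups\<close>

context profinite_group
begin

section \<open>The compact space of assignments and continuity of word maps\<close>

abbreviation assignment_topology :: "(nat \<Rightarrow> 'a) topology" where
  "assignment_topology \<equiv> product_topology (\<lambda>_. T) UNIV"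

lemma topspace_assignments: "topspace assignment_topology = assignments"
  by (simp add: topspace_eq PiE_UNIV_domain)

lemma continuous_map_mult:
  assumes "continuous_map X T f" "continuous_map X T f'"
  shows "continuous_map X T (\<lambda>x. f x \<otimes> f' x)"
  using continuous_map_compose[OF continuous_map_pairedI[OF assms] continuous_mult]
  by (simp add: o_def)

lemma continuous_map_word_map: "f \<in> word_maps \<Longrightarrow> continuous_map assignment_topology T f"
proof (induction rule: word_maps_induct)
  case one
  then show ?case by (simp add: topspace_eq)
next
  case (var i)
  show ?case by (rule continuous_map_product_projection) simp
next
  case (inv f)
  then show ?case using continuous_map_compose[OF inv.IH continuous_inv] by (simp add: o_def)
next
  case (mult f f')
  then show ?case by (intro continuous_map_mult)
next
  case (ext f f')
  then show ?case by (intro continuous_map_eq[OF ext.IH]) (simp only: topspace_assignments)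
qed

lemma continuous_map_fun_upd:
  assumes "continuous_map X assignment_topology f" "continuous_map X T u"
  shows "continuous_map X assignment_topology (\<lambda>x. (f x)(i := u x))"
  unfolding continuous_map_componentwise_UNIV
proof
  fix k
  show "continuous_map X T (\<lambda>x. ((f x)(i := u x)) k)"
    using assms by (cases "k = i") (simp_all add: continuous_map_componentwise_UNIV)
qed

lemma compactin_assignments: "compactin assignment_topology assignments"
  using compact compact_space_product_topology compact_space_def topspace_assignments by metis

text \<open>Finiteness of the image makes \<open>1\<close> isolated in it, so \<open>h = 1\<close>
  is an open condition. It holds at \<open>x_j = 1\<close> for all assignments, and the tube lemma
  over the compact space of assignments makes the neighbourhood uniform.\<close>

lemma finite_image_trivial_nbhd:
  assumes h: "h \<in> word_maps" and fin: "finite (h ` assignments)"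
    and one: "\<And>g. g \<in> assignments \<Longrightarrow> h (g(j := \<one>)) = \<one>"
  shows "\<exists>N. openin T N \<and> \<one> \<in> N \<and> (\<forall>g\<in>assignments. \<forall>n\<in>N. h (g(j := n)) = \<one>)"
proof -
  let ?P = "prod_topology assignment_topology T"
  have sub: "h ` assignments \<subseteq> topspace T" using word_maps_closed[OF h] topspace_eq by auto
  let ?O = "topspace T - (h ` assignments - {\<one>})"
  have O: "openin T ?O"
    using closedin_Hausdorff_finite[OF Hausdorff, of "h ` assignments - {\<one>}"] sub fin by blast
  have "continuous_map ?P assignment_topology (\<lambda>p. (fst p)(j := snd p))"
    by (intro continuous_map_fun_upd continuous_map_fst continuous_map_snd)
  then have "continuous_map ?P T (\<lambda>p. h ((fst p)(j := snd p)))"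
    using continuous_map_compose[OF _ continuous_map_word_map[OF h]] by (simp add: o_def)
  then have W: "openin ?P {p \<in> topspace ?P. h ((fst p)(j := snd p)) \<in> ?O}"
    using O by (rule openin_continuous_map_preimage)
  have "\<exists>U V. openin assignment_topology U \<and> openin T V \<and> assignments \<subseteq> U \<and> \<one> \<in> V \<and>
      U \<times> V \<subseteq> {p \<in> topspace ?P. h ((fst p)(j := snd p)) \<in> ?O}"
  proof (rule tube_lemma_left[OF W compactin_assignments])
    show "assignments \<times> {\<one>} \<subseteq> {p \<in> topspace ?P. h ((fst p)(j := snd p)) \<in> ?O}"
    proof
      fix p assume "p \<in> assignments \<times> {\<one>}"
      then have "fst p \<in> assignments" "snd p = \<one>" by auto
      then show "p \<in> {p \<in> topspace ?P. h ((fst p)(j := snd p)) \<in> ?O}"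
        using one[of "fst p"]
        by (simp add: mem_Times_iff topspace_eq PiE_UNIV_domain del: fun_upd_apply)
    qed
  qed (simp add: topspace_eq)
  then obtain U V where V: "openin T V" "\<one> \<in> V" "assignments \<subseteq> U"
    "U \<times> V \<subseteq> {p \<in> topspace ?P. h ((fst p)(j := snd p)) \<in> ?O}" by blast
  have "h (g(j := n)) = \<one>" if g: "g \<in> assignments" and n: "n \<in> V" for g n
  proof -
    have "n \<in> carrier G" using openin_subset[OF V(1)] n topspace_eq by auto
    then have "h (g(j := n)) \<in> h ` assignments" using fun_upd_assignment[OF g] by blast
    moreover have "(g, n) \<in> {p \<in> topspace ?P. h ((fst p)(j := snd p)) \<in> ?O}"
      using V(3,4) g n by blast
    then have "h (g(j := n)) \<in> ?O" by (simp only: mem_Collect_eq fst_conv snd_conv)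
    ultimately show ?thesis by blast
  qed
  then show ?thesis using V by blast
qed

text \<open>The image is compact, hence closed. Were it perfect, it would have at least continuum
  many points; so it has an isolated point, whose preimage is the required open set.\<close>

lemma small_image_locally_constant:
  assumes f: "continuous_map assignment_topology T f"
    and small: "f ` assignments \<prec> (UNIV :: nat set set)"
  shows "\<exists>a\<in>assignments. \<exists>U. openin assignment_topology U \<and> a \<in> U \<and> (\<forall>g\<in>U. f g = f a)"
proof -
  let ?S = "f ` assignments"
  have ne: "?S \<noteq> {}" by auto
  have "closedin T ?S"
    using image_compactin[OF compactin_assignments f] Hausdorff by (simp add: compactin_imp_closedin)
  then have S: "T derived_set_of ?S \<subseteq> ?S" "?S \<subseteq> topspace T"
    by (simp_all add: closedin_contains_derived_set)
  have "T derived_set_of ?S \<noteq> ?S"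
  proof
    assume "T derived_set_of ?S = ?S"
    then have "(UNIV :: real set) \<lesssim> ?S"
      using lepoll_perfect_set[OF _ _ ne] compact Hausdorff compact_imp_locally_compact_space by blast
    then have "(UNIV :: nat set set) \<lesssim> ?S"
      using lepoll_trans1[OF nat_sets_eqpoll_reals] by blast
    then show False using small lesspoll_trans2 lesspoll_not_refl by blast
  qed
  then obtain a where a: "a \<in> assignments" "f a \<notin> T derived_set_of ?S" using S(1) by auto
  moreover have "f a \<in> topspace T" using S(2) a(1) by blast
  ultimately have "\<exists>W. f a \<in> W \<and> openin T W \<and> \<not> (\<exists>y. y \<noteq> f a \<and> y \<in> ?S \<and> y \<in> W)"
    by (simp only: in_derived_set_of) blast
  then obtain W where W: "f a \<in> W" "openin T W" "\<And>y. \<lbrakk>y \<in> ?S; y \<in> W\<rbrakk> \<Longrightarrow> y = f a"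
    by metis
  have "openin assignment_topology {g \<in> topspace assignment_topology. f g \<in> W}"
    using f W(2) by (rule openin_continuous_map_preimage)
  moreover have "\<forall>g\<in>{g \<in> topspace assignment_topology. f g \<in> W}. f g = f a"
    using W(3) topspace_assignments by blast
  moreover have "a \<in> {g \<in> topspace assignment_topology. f g \<in> W}"
    using a W(1) topspace_assignments by blast
  ultimately show ?thesis using a(1) by blast
qed

section \<open>Finite images of locally multiplicative maps\<close>

lemma openin_left_translate:
  assumes "openin T U" "a \<in> carrier G"
  shows "openin T {x \<in> carrier G. a \<otimes> x \<in> U}"
proof -
  have "continuous_map T T (\<lambda>x. a \<otimes> x)"
    using assms(2) by (intro continuous_map_mult) (auto simp: topspace_eq)
  from openin_continuous_map_preimage[OF this assms(1)] show ?thesis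
    by (simp add: topspace_eq)
qed

lemma finite_translate_cover:
  assumes M: "openin T M" "\<one> \<in> M"
  shows "\<exists>F. finite F \<and> F \<subseteq> carrier G \<and> (\<forall>x\<in>carrier G. \<exists>t\<in>F. \<exists>m\<in>M. x = t \<otimes> m)"
proof -
  \<comment> \<open>\<open>?U t\<close> is the translate \<open>t M\<close>, written as a preimage
    so that continuity gives openness.\<close>
  let ?U = "\<lambda>t. {x \<in> carrier G. inv t \<otimes> x \<in> M}"
  have "\<exists>\<F>. finite \<F> \<and> \<F> \<subseteq> ?U ` carrier G \<and> topspace T \<subseteq> \<Union>\<F>"
  proof (rule compactinD)
    show "compactin T (topspace T)" using compact by (simp add: compact_space_def)
    show "topspace T \<subseteq> \<Union>(?U ` carrier G)" using M(2) by (force simp: topspace_eq)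
    show "openin T U" if "U \<in> ?U ` carrier G" for U
      using that openin_left_translate[OF M(1)] by auto
  qed
  then obtain F where F: "finite F" "F \<subseteq> carrier G" "topspace T \<subseteq> \<Union>(?U ` F)"
    by (metis (no_types, lifting) finite_subset_image)
  have "\<exists>t\<in>F. \<exists>m\<in>M. x = t \<otimes> m" if "x \<in> carrier G" for x
  proof -
    obtain t where t: "t \<in> F" "inv t \<otimes> x \<in> M" using F(3) \<open>x \<in> carrier G\<close> topspace_eq by auto
    then have "x = t \<otimes> (inv t \<otimes> x)" using F(2) that by (auto simp: inv_mult_cancel)
    then show ?thesis using t by blast
  qed
  then show ?thesis using F by blast
qed

text \<open>Induction on \<open>J\<close>. For nonempty \<open>J\<close>, multiplicativity
  transports constancy near some \<open>a\<close> to a neighbourhood of \<open>1\<close>, where the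
  value must be \<open>1\<close>. Each coordinate is then written as \<open>t m\<close> with
  \<open>t\<close> from a finite set and \<open>m\<close> near \<open>1\<close>, and fixing a
  coordinate at \<open>t\<close> leaves fewer variables.\<close>

lemma locally_multiadditive_finite_image:
  assumes "finite J" "continuous_map assignment_topology T f" "depends_on f J"
    and N: "openin T N" "\<one> \<in> N"
    and "\<And>i g x n. \<lbrakk>i \<in> J; g \<in> assignments; x \<in> carrier G; n \<in> N\<rbrakk>
      \<Longrightarrow> f (g(i := x \<otimes> n)) = f (g(i := x)) \<otimes> f (g(i := n))"
    and "f ` assignments \<prec> (UNIV :: nat set set)"
  shows "finite (f ` assignments)"
  using assms(1-3,6,7)
proof (induction J arbitrary: f rule: finite_psubset_induct)
  case (psubset J)
  note f = psubset.prems(1) and dep = depends_onD[OF psubset.prems(2)] and add = psubset.prems(3)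
  have fc: "f g \<in> carrier G" if "g \<in> assignments" for g
    using f that topspace_assignments topspace_eq by (metis continuous_map_image_subset_topspace image_subset_iff)
  obtain a U where a: "a \<in> assignments" and U: "openin assignment_topology U" "a \<in> U"
    "\<And>g. g \<in> U \<Longrightarrow> f g = f a"
    using small_image_locally_constant[OF f psubset.prems(4)] by blast
  obtain B where B: "\<And>i. openin T (B i)" "a \<in> Pi\<^sub>E UNIV B" "Pi\<^sub>E UNIV B \<subseteq> U"
    using U(1,2) unfolding openin_product_topology_alt by (metis UNIV_I)
  \<comment> \<open>\<open>M\<close> is small enough both for multiplicativity and for
    \<open>a i M\<close> to stay in \<open>B i\<close>. The factor \<open>topspace T\<close>
    accounts for the empty intersection when \<open>J = {}\<close>.\<close>
  define M where "M = N \<inter> ((\<Inter>i\<in>J. {x \<in> carrier G. a i \<otimes> x \<in> B i}) \<inter> topspace T)"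
  have ac: "a i \<in> carrier G" for i using a by auto
  have M: "openin T M"
    unfolding M_def using N(1) B(1) ac psubset.hyps
    by (intro openin_Int openin_INT openin_left_translate)
  have M': "\<one> \<in> M" "M \<subseteq> N" "M \<subseteq> carrier G"
    "\<And>i m. \<lbrakk>i \<in> J; m \<in> M\<rbrakk> \<Longrightarrow> a i \<otimes> m \<in> B i"
    unfolding M_def using N(2) B(2) ac topspace_eq by (auto simp: PiE_UNIV_domain Pi_def)
  note M = M M'
  \<comment> \<open>\<open>p K m\<close> leads from the box around \<open>a\<close>, at
    \<open>K = {}\<close>, to arguments in \<open>M\<close>, at \<open>K = J\<close>; variables
    outside \<open>J\<close> keep their value from \<open>a\<close>.\<close>
  define p where "p K m i = (if i \<in> K then m i else if i \<in> J then a i \<otimes> m i else a i)"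
    for K and m :: "nat \<Rightarrow> 'a" and i
  have pA: "p K m \<in> assignments" if "\<And>i. m i \<in> M" for K m
    using subsetD[OF M(4) that] ac by (auto simp: p_def)
  \<comment> \<open>The constant for \<open>K = {}\<close> is \<open>f a\<close>; as soon as one
    variable has moved from \<open>a k m k\<close> to \<open>m k\<close>, it is
    \<open>1\<close>.\<close>
  have const: "\<exists>c. (\<forall>m. (\<forall>i. m i \<in> M) \<longrightarrow> f (p K m) = c) \<and> (K \<noteq> {} \<longrightarrow> c = \<one>)"
    if "finite K" "K \<subseteq> J" for K
    using that
  proof (induction K)
    case empty
    have "f (p {} m) = f a" if "\<forall>i. m i \<in> M" for m
    proof (rule U(3))
      have "p {} m \<in> Pi\<^sub>E UNIV B" using that M(5) B(2) by (auto simp: p_def PiE_UNIV_domain)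
      then show "p {} m \<in> U" using B(3) by blast
    qed
    then show ?case by blast
  next
    case (insert k K)
    then obtain c where c: "\<And>m. \<forall>i. m i \<in> M \<Longrightarrow> f (p K m) = c" by auto
    have "f (p (insert k K) m) = \<one>" if m: "\<forall>i. m i \<in> M" for m
    proof -
      have mk: "m k \<in> N" "m k \<in> carrier G" using m M by auto
      have eq: "(p K m)(k := a k \<otimes> m k) = p K m" using insert by (auto simp: p_def)
      have "p K m \<in> assignments" using pA m by blast
      then have "f ((p K m)(k := a k \<otimes> m k)) = f ((p K m)(k := a k)) \<otimes> f ((p K m)(k := m k))"
        using insert.prems mk(1) ac by (intro add) auto
      then have "f (p K m) = f ((p K m)(k := a k)) \<otimes> f ((p K m)(k := m k))" by (simp only: eq)
      \<comment> \<open>Since \<open>1\<close> lies in \<open>M\<close>, this assignment also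
        belongs to the family for \<open>K\<close>. So \<open>c\<close> occurs on both sides and
        cancels, which leaves \<open>1\<close> for the other factor.\<close>
      moreover have "(p K m)(k := a k) = p K (m(k := \<one>))"
        using insert ac by (auto simp: p_def)
      moreover have "(p K m)(k := m k) = p (insert k K) m" by (auto simp: p_def)
      moreover have "\<forall>i. (m(k := \<one>)) i \<in> M" using m M(2) by auto
      ultimately have "c = c \<otimes> f (p (insert k K) m)" using c m by metis
      moreover have "c \<in> carrier G" using c[OF m] fc pA m by blast
      moreover have "f (p (insert k K) m) \<in> carrier G" using fc pA m by blast
      ultimately show ?thesis by (metis l_cancel_one')
    qed
    then show ?case by blast
  qed
  show ?case
  proof (cases "J = {}")
    case True
    then have "f ` assignments \<subseteq> {f a}" using dep[OF _ a] by blast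
    then show ?thesis by (rule finite_subset) simp
  next
    case False
    have trivial: "f g = \<one>" if g: "g \<in> assignments" "\<And>i. i \<in> J \<Longrightarrow> g i \<in> M" for g
    proof -
      \<comment> \<open>The family requires values in \<open>M\<close> for all variables, so those
        outside \<open>J\<close> get \<open>1\<close>.\<close>
      let ?m = "\<lambda>i. if i \<in> J then g i else \<one>"
      have m: "\<forall>i. ?m i \<in> M" using g(2) M(2) by auto
      have "f g = f (p J ?m)" by (rule dep[OF g(1) pA]) (use m in \<open>auto simp: p_def\<close>)
      also have "\<dots> = \<one>"
      proof -
        obtain c where c: "\<And>m. (\<forall>i. m i \<in> M) \<Longrightarrow> f (p J m) = c" "c = \<one>"
          using const[OF psubset.hyps order_refl] False by blast
        show ?thesis using c(1)[OF m] unfolding c(2) .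
      qed
      finally show ?thesis .
    qed
    obtain F where F: "finite F" "F \<subseteq> carrier G" "\<And>x. x \<in> carrier G \<Longrightarrow> \<exists>t\<in>F. \<exists>m\<in>M. x = t \<otimes> m"
      using finite_translate_cover[OF M(1,2)] by blast
    \<comment> \<open>Fixing the variable \<open>k\<close> preserves multiplicativity in the others
      with the same \<open>N\<close>, so the induction hypothesis applies to
      \<open>J - {k}\<close>.\<close>
    have slice: "finite ((\<lambda>g. f (g(k := t))) ` assignments)" if k: "k \<in> J" and t: "t \<in> carrier G" for k t
    proof (rule psubset.IH[of "J - {k}"])
      note upd = fun_upd_assignment[OF _ t]
      show "J - {k} \<subset> J" using k by blast
      have "continuous_map assignment_topology assignment_topology (\<lambda>g. g(k := t))"
        using continuous_map_fun_upd[OF continuous_map_id] t by (simp add: topspace_eq)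
      then show "continuous_map assignment_topology T (\<lambda>g. f (g(k := t)))"
        using continuous_map_compose[OF _ f] by (simp add: o_def)
      show "depends_on (\<lambda>g. f (g(k := t))) (J - {k})"
        unfolding depends_on_def by (intro ballI impI dep upd) auto
      show "f ((g(i := x \<otimes> n))(k := t)) = f ((g(i := x))(k := t)) \<otimes> f ((g(i := n))(k := t))"
        if "i \<in> J - {k}" "g \<in> assignments" "x \<in> carrier G" "n \<in> N" for i g x n
      proof -
        have "(g(i := y))(k := t) = (g(k := t))(i := y)" for y using that(1) by auto
        then show ?thesis using add[OF _ upd[OF that(2)] that(3,4)] that(1) by (simp del: fun_upd_apply)
      qed
      have "(\<lambda>g. f (g(k := t))) ` assignments \<subseteq> f ` assignments" using upd by blast
      then show "(\<lambda>g. f (g(k := t))) ` assignments \<prec> (UNIV :: nat set set)"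
        using psubset.prems(4) subset_imp_lepoll lesspoll_trans1 by blast
    qed
    \<comment> \<open>\<open>K\<close> holds the variables already released from \<open>M\<close>.
      For \<open>K = {}\<close> the only value is \<open>1\<close>, each release multiplies by
      values from finitely many slices, and at \<open>K = J\<close> all assignments are
      covered.\<close>
    have "finite (f ` {g \<in> assignments. \<forall>i\<in>J - K. g i \<in> M})" if "finite K" "K \<subseteq> J" for K
      using that
    proof (induction K)
      case empty
      have "f ` {g \<in> assignments. \<forall>i\<in>J - {}. g i \<in> M} \<subseteq> {\<one>}" using trivial by auto
      then show ?case by (rule finite_subset) simp
    next
      case (insert k K)
      let ?A = "\<Union>t\<in>F. (\<lambda>g. f (g(k := t))) ` assignments"
      let ?B = "f ` {g \<in> assignments. \<forall>i\<in>J - K. g i \<in> M}"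
      have "f g \<in> (\<lambda>(x, y). x \<otimes> y) ` (?A \<times> ?B)"
        if g: "g \<in> assignments" "\<forall>i\<in>J - insert k K. g i \<in> M" for g
      proof -
        have "g k \<in> carrier G" using g(1) by auto
        then obtain t m where tm: "t \<in> F" "m \<in> M" "g k = t \<otimes> m" using F(3) by blast
        have "f (g(k := t \<otimes> m)) = f (g(k := t)) \<otimes> f (g(k := m))"
          using add[of k g t m] insert.prems g(1) tm F(2) M(3) by blast
        then have "f g = f (g(k := t)) \<otimes> f (g(k := m))" by (simp flip: tm(3))
        moreover have "g(k := m) \<in> {g \<in> assignments. \<forall>i\<in>J - K. g i \<in> M}"
          using fun_upd_assignment[OF g(1) subsetD[OF M(4) tm(2)]] g(2) tm(2) by simp
        ultimately show ?thesis using g(1) tm(1) by force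
      qed
      then have "f ` {g \<in> assignments. \<forall>i\<in>J - insert k K. g i \<in> M} \<subseteq> (\<lambda>(x, y). x \<otimes> y) ` (?A \<times> ?B)"
        by blast
      moreover have "finite ?A" using F slice insert.prems by blast
      moreover have "finite ?B" using insert by blast
      ultimately show ?case by (meson finite_SigmaI finite_imageI finite_subset)
    qed
    from this[OF psubset.hyps order_refl] show ?thesis by simp
  qed
qed

text \<open>Finiteness for the derivatives serves twice: it makes them trivial for second arguments
  near \<open>1\<close>, so that \<open>f\<close> is locally multiplicative and has finite image,
  and it bounds the powers of the values, which gives the torsion for Dietzmann's lemma.\<close>

lemma finite_generate_if_derivatives_finite:
  assumes f: "f \<in> word_maps" "finite K" "depends_on f K"
    and vanish: "\<And>k g. \<lbrakk>k \<in> K; g \<in> assignments\<rbrakk> \<Longrightarrow> f (g(k := \<one>)) = \<one>"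
    and small: "f ` assignments \<prec> (UNIV :: nat set set)"
    and D: "\<And>i j. \<lbrakk>i \<in> K; j \<notin> K\<rbrakk> \<Longrightarrow> finite (generate G (derivative f i j ` assignments))"
  shows "finite (generate G (f ` assignments))"
proof -
  obtain j where j: "j \<notin> K" using f(2) ex_new_if_finite infinite_UNIV_nat by blast
  have "\<exists>N. openin T N \<and> \<one> \<in> N \<and> (\<forall>g\<in>assignments. \<forall>n\<in>N. derivative f i j (g(j := n)) = \<one>)"
    if "i \<in> K" for i
  proof (rule finite_image_trivial_nbhd)
    show "finite (derivative f i j ` assignments)"
      by (rule finite_subset[OF _ D[OF that j]]) (blast intro: generate.incl)
    show "derivative f i j (g(j := \<one>)) = \<one>" if "g \<in> assignments" for g
      using derivative_vanishing[OF f(1,3) \<open>i \<in> K\<close> j vanish _ that] by blast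
  qed (rule derivative_word_maps[OF f(1)])
  then obtain N where N: "\<And>i. i \<in> K \<Longrightarrow> openin T (N i)" "\<And>i. i \<in> K \<Longrightarrow> \<one> \<in> N i"
    "\<And>i g n. \<lbrakk>i \<in> K; g \<in> assignments; n \<in> N i\<rbrakk> \<Longrightarrow> derivative f i j (g(j := n)) = \<one>"
    by metis
  have fin: "finite (f ` assignments)"
  proof (rule locally_multiadditive_finite_image[OF f(2) continuous_map_word_map[OF f(1)] f(3) _ _ _ small])
    show "openin T ((\<Inter>i\<in>K. N i) \<inter> topspace T)" using f(2) N(1) by (rule openin_INT)
    show "\<one> \<in> (\<Inter>i\<in>K. N i) \<inter> topspace T" using N(2) by (auto simp: topspace_eq)
    fix i g x n
    assume i: "i \<in> K" and g: "g \<in> assignments" and x: "x \<in> carrier G"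
      and n: "n \<in> (\<Inter>i\<in>K. N i) \<inter> topspace T"
    have "derivative f i j (g(i := x, j := n)) = \<one>"
      using N(3)[OF i fun_upd_assignment[OF g x]] i n by blast
    moreover have nc: "n \<in> carrier G" using n topspace_eq by auto
    ultimately show "f (g(i := x \<otimes> n)) = f (g(i := x)) \<otimes> f (g(i := n))"
      using derivative_expand[OF f(1,3) i j g x nc] word_maps_closed[OF f(1) fun_upd_assignment[OF g x]]
      by simp
  qed
  show ?thesis
  proof (rule finite_generate_torsion[OF fin])
    show "f ` assignments \<subseteq> carrier G" using word_maps_closed[OF f(1)] by auto
    show "y \<otimes> s \<otimes> inv y \<in> f ` assignments" if s: "s \<in> f ` assignments" and y: "y \<in> carrier G" for s y
    proof -
      obtain g where g: "s = f g" "g \<in> assignments" using s by blast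
      then have "(\<lambda>i. y \<otimes> g i \<otimes> inv y) \<in> assignments" using y by auto
      then show ?thesis using word_maps_conj[OF f(1) g(2) y] g(1) by blast
    qed
    show "\<exists>n>0. s [^] (n :: nat) = \<one>" if s: "s \<in> f ` assignments" for s
    proof -
      obtain g where g: "s = f g" "g \<in> assignments" using s by blast
      show ?thesis
      proof (cases "K = {}")
        case True
        \<comment> \<open>Without variables, \<open>f\<close> is constant and equals its value at
          the trivial assignment.\<close>
        then have "f g = f (\<lambda>i. \<one>)" by (intro depends_onD[OF f(3) g(2)]) auto
        then show ?thesis using g(1) word_maps_one_assignment[OF f(1)] by (intro exI[of _ 1]) simp
      next
        case False
        then obtain i where i: "i \<in> K" by blast
        show ?thesis
          unfolding g(1) by (rule torsion_values[OF f(1,3) i j vanish[OF i] fin D[OF i j] g(2)])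
      qed
    qed
  qed
qed

text \<open>
  The outer induction is on the number of variables in which \<open>f\<close> vanishes, downwards from the
  nilpotency class; the inner one removes the variables in which \<open>f\<close> does not vanish.
\<close>

lemma finite_generate_word_map:
  assumes central: "lower_central G c = {\<one>}"
    and "f \<in> word_maps" "finite J" "finite K" "depends_on f (J \<union> K)"
    and "\<And>k g. \<lbrakk>k \<in> K; g \<in> assignments\<rbrakk> \<Longrightarrow> f (g(k := \<one>)) = \<one>"
    and "f ` assignments \<prec> (UNIV :: nat set set)" "c < card K + n"
  shows "finite (generate G (f ` assignments))"
  using assms(2-)
proof (induction n arbitrary: f J K)
  case 0
  \<comment> \<open>At \<open>n = 0\<close>, \<open>f\<close> vanishes in more than \<open>c\<close>
    variables.\<close>
  have "f ` assignments \<subseteq> {\<one>}"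
    using vanishing_trivial[OF 0(3) _ central 0(1) 0(5)] 0(7) by auto
  then have "generate G (f ` assignments) \<subseteq> {\<one>}"
    using generate_subgroup_incl[OF _ triv_subgroup] by blast
  then show ?case by (rule finite_subset) simp
next
  case (Suc n)
  from Suc.prems(2,1,3-) show ?case
  proof (induction J arbitrary: f K rule: finite_induct)
    case empty
    show ?case
    proof (rule finite_generate_if_derivatives_finite[OF empty(1,2)])
      show dep: "depends_on f K" using empty(3) by simp
      fix i j assume ij: "i \<in> K" "j \<notin> K"
      show "finite (generate G (derivative f i j ` assignments))"
      \<comment> \<open>The derivative vanishes in one more variable, which pays for the decrease of
        \<open>n\<close>.\<close>
      proof (rule Suc.IH[of _ "{}" "insert j K"])
        show "c < card (insert j K) + n" using empty(2,6) ij(2) by simp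
        show "depends_on (derivative f i j) ({} \<union> insert j K)"
          using derivative_depends_on[OF dep ij(1)] by simp
        show "derivative f i j (g(k := \<one>)) = \<one>" if "k \<in> insert j K" "g \<in> assignments" for k g
          by (rule derivative_vanishing[OF empty(1) dep ij empty(4) that])
      qed (use empty derivative_word_maps derivative_lesspoll in auto)
    qed (use empty in auto)
  next
    case (insert i J)
    note f = insert.prems(1)
    note fc = word_maps_closed[OF f]
    show ?case
    proof (cases "i \<in> K")
      case True
      then have "insert i J \<union> K = J \<union> K" by blast
      then show ?thesis using insert.IH[OF f insert.prems(2)] insert.prems by simp
    next
      case False
      \<comment> \<open>\<open>f\<close> is the product of \<open>?f0\<close>, which no longer
        depends on \<open>i\<close>, and \<open>?f1\<close>, which vanishes also in
        \<open>i\<close>; so \<open>i\<close> leaves \<open>J\<close> in both cases.\<close>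
      let ?f0 = "\<lambda>g. f (g(i := \<one>))" and ?f1 = "\<lambda>g. inv (f (g(i := \<one>))) \<otimes> f g"
      note upd = fun_upd_assignment[OF _ one_closed, of _ i]
      have f0: "?f0 \<in> word_maps" by (rule word_maps_fun_upd[OF f word_maps_one])
      have f1: "?f1 \<in> word_maps" by (rule word_maps_mult[OF word_maps_inv[OF f0] f])
      have vanish0: "?f0 (g(k := \<one>)) = \<one>" if "k \<in> K" "g \<in> assignments" for k g
        using insert.prems(4)[OF that(1) upd[OF that(2)]] False that(1)
        by (metis fun_upd_twist)
      have small0: "?f0 ` assignments \<prec> (UNIV :: nat set set)"
      proof -
        have "?f0 ` assignments \<subseteq> f ` assignments" using upd by blast
        then show ?thesis using insert.prems(5) subset_imp_lepoll lesspoll_trans1 by blast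
      qed
      have "finite (generate G (?f0 ` assignments))"
      proof (rule insert.IH[OF f0 insert.prems(2) _ vanish0 small0 insert.prems(6)])
        show "depends_on ?f0 (J \<union> K)"
          unfolding depends_on_def
        proof (intro ballI impI)
          fix g g' assume "g \<in> assignments" "g' \<in> assignments" "\<forall>i\<in>J \<union> K. g i = g' i"
          then show "?f0 g = ?f0 g'" by (intro depends_onD[OF insert.prems(3)] upd) auto
        qed
      qed
      moreover have "finite (generate G (?f1 ` assignments))"
      proof (rule insert.IH[of _ "insert i K"])
        show "depends_on ?f1 (J \<union> insert i K)"
          unfolding depends_on_def
        proof (intro ballI impI)
          fix g g' assume g: "g \<in> assignments" "g' \<in> assignments" "\<forall>k\<in>J \<union> insert i K. g k = g' k"
          then have "f g = f g'" by (intro depends_onD[OF insert.prems(3)]) auto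
          moreover have "?f0 g = ?f0 g'"
            using g by (intro depends_onD[OF insert.prems(3)] upd) auto
          ultimately show "?f1 g = ?f1 g'" by simp
        qed
        show "?f1 (g(k := \<one>)) = \<one>" if k: "k \<in> insert i K" and g: "g \<in> assignments" for k g
        proof (cases "k = i")
          case True
          then show ?thesis using fc[OF upd[OF g]] by (simp del: fun_upd_apply)
        next
          case False
          then show ?thesis using vanish0[OF _ g] insert.prems(4)[OF _ g] k by (simp del: fun_upd_apply)
        qed
        show "?f1 ` assignments \<prec> (UNIV :: nat set set)"
          by (rule lesspoll_mult_image[OF small0 insert.prems(5), of _ _ "\<lambda>x y. inv x \<otimes> y"]) blast
        \<comment> \<open>Here \<open>n\<close> stays fixed, as enlarging \<open>K\<close> only
          relaxes the bound.\<close>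
        show "c < card (insert i K) + Suc n" using insert.prems(2,6) False by simp
      qed (use f1 insert.prems(2) in \<open>simp_all del: fun_upd_apply\<close>)
      ultimately show ?thesis
        by (rule finite_generate_mult[OF f0 f1])
          (simp add: fc[OF upd] fc inv_mult_cancel del: fun_upd_apply)
    qed
  qed
qed

end

section \<open>From word maps to the verbal subgroup\<close>

theorem theorem1p2:
  fixes G :: "('a, 'b) monoid_scheme" and T :: "'a topology"
    and r :: nat and w :: "(nat \<times> bool) list"
  assumes "w \<in> carrier (free_group {1..r})"
    and "profinite_group G T"
    and "nilpotent_group G"
    and "word_values G r w \<prec> (UNIV :: nat set set)"
  shows "finite (verbal_subgroup G T r w)"
proof -
  interpret profinite_group G T by fact
  obtain c where c: "lower_central G c = {\<one>\<^bsub>G\<^esub>}"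
    using assms(3) by (auto simp: nilpotent_group_def)
  let ?f = "\<lambda>g. word_value G g w"
  have dep: "depends_on ?f {1..r}"
    using assms(1) by (intro depends_on_word_value) (auto simp: free_group_def)
  have eq: "?f ` assignments = word_values G r w"
  proof
    show "word_values G r w \<subseteq> ?f ` assignments"
    proof
      fix x assume "x \<in> word_values G r w"
      then obtain g where g: "x = word_value G g w" "g \<in> {1..r} \<rightarrow> carrier G"
        by (auto simp: word_values_def)
      \<comment> \<open>\<open>g\<close> is constrained only on \<open>{1..r}\<close>; the value
        \<open>1\<close> elsewhere turns it into an assignment.\<close>
      let ?g = "\<lambda>i. if i \<in> {1..r} then g i else \<one>\<^bsub>G\<^esub>"
      have "fst ` set w \<subseteq> {1..r}" using assms(1) by (simp add: free_group_def)
      then have "word_value G g w = word_value G ?g w"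
        by (induction w) (auto simp: word_value_def)
      moreover have "?g \<in> assignments" using g(2) by auto
      ultimately show "x \<in> ?f ` assignments" using g(1) by blast
    qed
  qed (auto simp: word_values_def)
  have fin: "finite (generate G (word_values G r w))"
    \<comment> \<open>At the start no vanishing is known, so \<open>K = {}\<close>, and
      \<open>n = Suc c\<close> meets the bound \<open>c < card K + n\<close>.\<close>
    using finite_generate_word_map[OF c word_maps_word_value, of "{1..r}" "{}" w "Suc c"] dep assms(4)
    by (simp add: eq)
  have sub: "word_values G r w \<subseteq> carrier G"
    using word_maps_closed[OF word_maps_word_value] by (auto simp flip: eq)
  \<comment> \<open>Finite sets are closed in a Hausdorff space, so the abstractly generated
    subgroup is among those being intersected.\<close>
  have "verbal_subgroup G T r w \<subseteq> generate G (word_values G r w)"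
    unfolding verbal_subgroup_def closed_subgroup_generated_def
  proof (rule Inter_lower, intro CollectI conjI)
    show "subgroup (generate G (word_values G r w)) G" by (rule generate_is_subgroup[OF sub])
    show "closedin T (generate G (word_values G r w))"
      using closedin_Hausdorff_finite[OF Hausdorff _ fin] generate_incl[OF sub] topspace_eq by simp
    show "word_values G r w \<subseteq> generate G (word_values G r w)" by (blast intro: generate.incl)
  qed
  then show ?thesis using fin by (rule finite_subset)
qed

end
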